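(* Fix an integer $d \ge 1$. (a) For any two $d$-polytopes $Q, Q' \subset \mathbb{R}^d$ that are both combinatorially equivalent to the $d$-cube, there exist a positive integer $s \le 8d$ and combinatorial $d$-cubes $Q = P_0, P_1, \dots, P_s = Q'$ in $\mathbb{R}^d$ such that for each $1 \le j \le s$ the polytope $P_j$ is obtained from $P_{j-1}$ either by a projective transformation (i.e. $P_{j-1}$ and $P_j$ are projectively equivalent) or by a normal transformation (i.e. $P_{j-1}$ and $P_j$ are normally equivalent). (b) The realization space of the $d$-cube is contractible; indeed, it deformation retracts onto the point corresponding to the standard cube.
   Context: A projective transformation is a map $\varphi(x) = \frac{Ax+b}{c^Tx+\alpha}$ with $A \in \mathbb{R}^{d\times d}$, $b,c \in \mathbb{R}^d$, $\alpha \in \mathbb{R}$, and $\det\begin{pmatrix} A & b\\ c^T & \alpha\end{pmatrix} \ne 0$. Two $d$-polytopes $P, Q$ are projectively equivalent if $Q = \varphi(P)$ for a projective transformation $\varphi$ whose denominator $c^Tx+\alpha$ does not vanish on $P$. Two $d$-polytopes are normally equivalent if they have the same set of (unit) facet outer normal vectors; passing from one to the other is called a normal transformation. A combinatorial $d$-cube is a $d$-polytope combinatorially equivalent to $[0,1]^d$. The realization space of the $d$-cube is the set of all combinatorial $d$-cubes in $\mathbb{R}^d$ with vertices labeled compatibly with a fixed labeling of the vertices of $[0,1]^d$, viewed as a subset of $(\mathbb{R}^d)^{2^d}$ with the subspace topology. The standard cube is the axis-parallel unit cube centered at the origin.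
   Formalization: In (b) the space of all labeled cubes is disconnected for every d (both orientations occur), so the realization space is taken modulo affine maps: one vertex and its d neighbours are fixed where they are in the standard cube. *)

theory Defs
  imports "HOL-Analysis.Analysis"
begin

definition d_polytope :: "(real^'n) set \<Rightarrow> bool" where
  "d_polytope P \<longleftrightarrow> polytope P \<and> aff_dim P = int CARD('n)"

definition face_lattice_iso ::
    "((real^'n) set \<Rightarrow> (real^'n) set) \<Rightarrow> (real^'n) set \<Rightarrow> (real^'n) set \<Rightarrow> bool" where
  "face_lattice_iso f P Q \<longleftrightarrow>
     bij_betw f {F. F face_of P} {G. G face_of Q} \<and>
     (\<forall>F F'. F face_of P \<longrightarrow> F' face_of P \<longrightarrow> (F \<subseteq> F' \<longleftrightarrow> f F \<subseteq> f F'))"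

definition combinatorially_equivalent :: "(real^'n) set \<Rightarrow> (real^'n) set \<Rightarrow> bool" where
  "combinatorially_equivalent P Q \<longleftrightarrow> (\<exists>f. face_lattice_iso f P Q)"

definition combinatorial_cube :: "(real^'n) set \<Rightarrow> bool" where
  "combinatorial_cube P \<longleftrightarrow> d_polytope P \<and> combinatorially_equivalent (cbox 0 1) P"


text \<open>The block matrix with rows \<open>(A b)\<close> and \<open>(c\<^sup>T \<alpha>)\<close>; \<open>None\<close> is the additional index.\<close>

definition projective_matrix ::
    "real^'n^'n \<Rightarrow> real^'n \<Rightarrow> real^'n \<Rightarrow> real \<Rightarrow> real^('n option)^('n option)" where
  "projective_matrix A b c \<alpha> =
     (\<chi> i j. case i of
        Some i' \<Rightarrow> (case j of Some j' \<Rightarrow> A $ i' $ j' | None \<Rightarrow> b $ i')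
      | None \<Rightarrow> (case j of Some j' \<Rightarrow> c $ j' | None \<Rightarrow> \<alpha>))"

definition projective_map ::
    "real^'n^'n \<Rightarrow> real^'n \<Rightarrow> real^'n \<Rightarrow> real \<Rightarrow> real^'n \<Rightarrow> real^'n" where
  "projective_map A b c \<alpha> x = (A *v x + b) /\<^sub>R (c \<bullet> x + \<alpha>)"

definition projectively_equivalent :: "(real^'n) set \<Rightarrow> (real^'n) set \<Rightarrow> bool" where
  "projectively_equivalent P Q \<longleftrightarrow>
     (\<exists>A b c \<alpha>. det (projective_matrix A b c \<alpha>) \<noteq> 0 \<and>
        (\<forall>x\<in>P. c \<bullet> x + \<alpha> \<noteq> 0) \<and> Q = projective_map A b c \<alpha> ` P)"

definition facet_normals :: "(real^'n) set \<Rightarrow> (real^'n) set" where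
  "facet_normals P =
     {u. norm u = 1 \<and>
         (\<exists>F \<beta>. F facet_of P \<and> (\<forall>x\<in>P. u \<bullet> x \<le> \<beta>) \<and> F = P \<inter> {x. u \<bullet> x = \<beta>})}"

definition normally_equivalent :: "(real^'n) set \<Rightarrow> (real^'n) set \<Rightarrow> bool" where
  "normally_equivalent P Q \<longleftrightarrow> facet_normals P = facet_normals Q"


text \<open>The vertices of \<open>[0,1]\<^sup>d\<close> are labelled by the subsets of the index type (the positions of
  the coordinates equal to \<open>1\<close>), so \<open>(real^'n)^('n set)\<close> is the space of \<open>2\<^sup>d\<close>-tuples of points.\<close>

definition cube_vertex :: "'n set \<Rightarrow> real^'n" where
  "cube_vertex S = (\<chi> i. if i \<in> S then 1 else 0)"

definition cube_realizations :: "((real^'n)^('n set)) set" where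
  "cube_realizations =
     {v. d_polytope (convex hull (range (($) v))) \<and>
         (\<exists>f. face_lattice_iso f (cbox 0 1) (convex hull (range (($) v))) \<and>
              (\<forall>S. f {cube_vertex S} = {v $ S}))}"

definition standard_cube :: "(real^'n)^('n set)" where
  "standard_cube = (\<chi> S i. if i \<in> S then 1/2 else -1/2)"

text \<open>The affine group acts freely on \<open>cube_realizations\<close>, and \<open>cube_realizations\<close> itself
  is never contractible (\<open>cube_realizations_not_contractible\<close> below). As usual for realization
  spaces of polytopes, realizations are therefore considered up to affine transformations, by fixing
  the position of an affine basis consisting of vertices: a vertex and its neighbours. Every labelled
  realization has exactly one affine image of this form
  (\<open>cube_realization_affine_normal_form\<close> below).\<close>

definition cube_realization_space :: "((real^'n)^('n set)) set" where
  "cube_realization_space =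
     {v \<in> cube_realizations.
        v $ {} = standard_cube $ {} \<and> (\<forall>i. v $ {i} = standard_cube $ {i})}"

text \<open>The homotopy is required to be stationary on the subspace.\<close>

definition deformation_retracts_onto :: "'a::topological_space set \<Rightarrow> 'a set \<Rightarrow> bool" where
  "deformation_retracts_onto X A \<longleftrightarrow>
     (\<exists>r. retraction X A r \<and> homotopic_with_canon (\<lambda>h. \<forall>a\<in>A. h a = a) X X id r)"


lemma cube_realization_affine_image:
  fixes v :: "(real^'n)^('n set)"
  assumes v: "v \<in> cube_realizations" and A: "invertible A"
  shows "(\<chi> S. A *v (v $ S) + b) \<in> cube_realizations"
proof -
  define h where "h = (\<lambda>x. A *v x + b)"
  define P where "P = convex hull (range (($) v))"
  have injA: "inj ((*v) A)"
    using A inj_matrix_vector_mult by blast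
  have linA: "linear ((*v) A)" by simp
  have injh: "inj h"
    using injA by (auto simp: h_def inj_def)
  have him: "h ` X = (+) b ` ((*v) A ` X)" for X
    by (auto simp: h_def image_image add.commute)
  have hface: "h ` F face_of h ` X \<longleftrightarrow> F face_of X" for F X
    unfolding him by (simp add: face_of_linear_image[OF linA injA])
  have hull: "convex hull (range (($) (\<chi> S. A *v (v $ S) + b))) = h ` P"
  proof -
    have "range (($) (\<chi> S. A *v (v $ S) + b)) = h ` range (($) v)"
      by (auto simp: h_def)
    then show ?thesis
      unfolding P_def him
      by (simp add: convex_hull_translation convex_hull_linear_image[OF linA, symmetric])
  qed
  from v obtain f where P: "d_polytope P" and f: "face_lattice_iso f (cbox 0 1) P"
    and fv: "\<And>S. f {cube_vertex S} = {v $ S}"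
    by (auto simp: cube_realizations_def P_def)
  have "d_polytope (h ` P)"
    using P unfolding d_polytope_def him
    by (simp add: polytope_translation_eq polytope_linear_image aff_dim_translation_eq
        aff_dim_injective_linear_image[OF linA injA])
  moreover have "face_lattice_iso (\<lambda>F. h ` f F) (cbox 0 1) (h ` P)"
  proof -
    have "bij_betw ((`) h) {F. F face_of P} {G. G face_of h ` P}"
    proof (rule bij_betw_imageI)
      show "inj_on ((`) h) {F. F face_of P}"
        using injh by (simp add: inj_on_def inj_image_eq_iff)
      show "(`) h ` {F. F face_of P} = {G. G face_of h ` P}"
      proof (intro equalityI subsetI)
        fix G assume "G \<in> {G. G face_of h ` P}"
        then have G: "G face_of h ` P" by simp
        then obtain F where "G = h ` F"
          using face_of_imp_subset subset_imageE by meson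
        with G show "G \<in> (`) h ` {F. F face_of P}" by (auto simp: hface)
      qed (auto simp: hface)
    qed
    then show ?thesis
      using f bij_betw_trans[of f _ _ "(`) h"] injh
      by (auto simp: face_lattice_iso_def o_def inj_image_subset_iff)
  qed
  moreover have "h ` f {cube_vertex S} = {(\<chi> S. A *v (v $ S) + b) $ S}" for S
    by (simp add: fv h_def)
  ultimately show ?thesis
    unfolding cube_realizations_def mem_Collect_eq hull by blast
qed

lemma cube_vertex_realization:
  "(\<chi> S. cube_vertex S) \<in> (cube_realizations :: ((real^'n)^('n set)) set)"
proof -
  have "x \<in> range cube_vertex" if "\<forall>i. x $ i = 0 \<or> x $ i = 1" for x :: "real^'n"
  proof
    show "x = cube_vertex {i. x $ i = 1}"
      using that by (auto simp: cube_vertex_def vec_eq_iff)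
  qed simp
  then have "range (cube_vertex :: 'n set \<Rightarrow> real^'n) = {x. \<forall>i. x $ i = 0 \<or> x $ i = 1}"
    by (auto simp: cube_vertex_def)
  then have hull: "convex hull (range (($) (\<chi> S. cube_vertex S))) = cbox (0::real^'n) 1"
    unfolding Cart_1 unit_interval_convex_hull by (simp add: Basis_vec_def inner_axis)
  have "box (0::real^'n) 1 \<noteq> {}"
    by (simp add: interval_ne_empty_cart)
  then have "d_polytope (cbox (0::real^'n) 1)"
    by (simp add: d_polytope_def polytope_interval aff_dim_nonempty_interior interior_cbox)
  moreover have "face_lattice_iso id (cbox (0::real^'n) 1) (cbox 0 1)"
    by (simp add: face_lattice_iso_def)
  ultimately show ?thesis
    unfolding cube_realizations_def mem_Collect_eq hull by (auto intro!: exI[of _ id])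
qed

lemma standard_cube_realization:
  "standard_cube \<in> (cube_realization_space :: ((real^'n)^('n set)) set)"
proof -
  have "standard_cube = (\<chi> S::'n set. mat 1 *v ((\<chi> S. cube_vertex S) $ S) + (\<chi> i. -1/2))"
    by (auto simp: standard_cube_def cube_vertex_def vec_eq_iff)
  also have "\<dots> \<in> cube_realizations"
    by (intro cube_realization_affine_image cube_vertex_realization)
      (auto simp: invertible_def)
  finally show ?thesis
    by (simp add: cube_realization_space_def)
qed

definition edge_matrix :: "(real^'n)^('n set) \<Rightarrow> real^'n^'n" where
  "edge_matrix v = (\<chi> i j. v $ {j} $ i - v $ {} $ i)"

lemma column_edge_matrix: "column j (edge_matrix v) = v $ {j} - v $ {}"
  by (simp add: column_def edge_matrix_def vec_eq_iff)

lemma edge_matrix_affine_image: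
  "edge_matrix (\<chi> S. A *v (v $ S) + b) = A ** edge_matrix v"
  by (simp add: edge_matrix_def matrix_matrix_mult_def matrix_vector_mult_def vec_eq_iff
      algebra_simps sum_subtractf)

lemma edge_matrix_standard_cube: "edge_matrix standard_cube = mat 1"
  by (simp add: edge_matrix_def standard_cube_def mat_def vec_eq_iff)

lemma invertible_edge_matrix:
  fixes v :: "(real^'n)^('n set)"
  assumes v: "v \<in> cube_realizations"
  shows "invertible (edge_matrix v)"
proof -
  define P where "P = convex hull (range (($) v))"
  from v obtain f where f: "face_lattice_iso f (cbox 0 1) P"
    and fv: "\<And>S. f {cube_vertex S} = {v $ S}"
    by (auto simp: cube_realizations_def P_def)
  have vface: "{cube_vertex S} face_of cbox (0::real^'n) 1" for S
  proof -
    show ?thesis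
      unfolding face_of_singleton extreme_point_of_def
    proof (intro conjI ballI notI)
      show "cube_vertex S \<in> cbox (0::real^'n) 1"
        by (auto simp: cube_vertex_def mem_box_cart)
    next
      fix x y :: "real^'n"
      assume x: "x \<in> cbox 0 1" and y: "y \<in> cbox 0 1"
        and seg: "cube_vertex S \<in> open_segment x y"
      then obtain t where t: "0 < t" "t < 1" and eq: "cube_vertex S = (1-t) *\<^sub>R x + t *\<^sub>R y"
        and "x \<noteq> y"
        by (auto simp: in_segment)
      have "x $ i = y $ i" for i
      proof (cases "i \<in> S")
        case True
        then have "(1-t) * (1 - x$i) + t * (1 - y$i) = 0"
          using arg_cong[OF eq, of "\<lambda>z. z $ i"] by (simp add: cube_vertex_def algebra_simps)
        moreover have "0 \<le> (1-t) * (1 - x$i)" "0 \<le> t * (1 - y$i)"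
          using t x y by (auto simp: mem_box_cart)
        ultimately have "(1-t) * (1 - x$i) = 0" "t * (1 - y$i) = 0" by linarith+
        then show ?thesis using t by simp
      next
        case False
        then have "(1-t) * (x$i) + t * (y$i) = 0"
          using arg_cong[OF eq, of "\<lambda>z. z $ i"] by (simp add: cube_vertex_def)
        moreover have "0 \<le> (1-t) * (x$i)" "0 \<le> t * (y$i)"
          using t x y by (auto simp: mem_box_cart)
        ultimately have "(1-t) * (x$i) = 0" "t * (y$i) = 0" by linarith+
        then show ?thesis using t by simp
      qed
      with \<open>x \<noteq> y\<close> show False by (simp add: vec_eq_iff)
    qed
  qed
  have "c k = 0" if sum0: "(\<Sum>i\<in>UNIV. c i *s column i (edge_matrix v)) = 0" for c k
  proof (rule ccontr)
    assume ck: "c k \<noteq> 0"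
    define F where "F = cbox (0::real^'n) 1 \<inter> {x. axis k 1 \<bullet> x = 0}"
    have F: "F face_of cbox 0 1"
      unfolding F_def
      by (rule face_of_Int_supporting_hyperplane_ge) (auto simp: mem_box_cart inner_axis')
    have inF: "{cube_vertex S} \<subseteq> F \<longleftrightarrow> k \<notin> S" for S
      by (auto simp: F_def cube_vertex_def mem_box_cart inner_axis')
    have iff: "v $ S \<in> f F \<longleftrightarrow> k \<notin> S" for S
      using f vface[of S] F inF[of S] fv[of S] by (auto simp: face_lattice_iso_def)
    have fF: "f F face_of P"
      using f F by (auto simp: face_lattice_iso_def bij_betw_def)
    define A where "A = affine hull (f F)"
    have memA: "v $ S \<in> A" if "k \<notin> S" for S
      using that iff unfolding A_def by (simp add: hull_inc)
    define W where "W = (\<lambda>x. x - v $ {}) ` A"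
    have W: "subspace W"
      unfolding W_def
      by (rule affine_diffs_subspace_subtract) (auto simp: A_def memA[unfolded A_def])
    have "c k *s (v $ {k} - v $ {}) = - (\<Sum>i\<in>UNIV-{k}. c i *s (v $ {i} - v $ {}))"
      using sum0 by (simp add: column_edge_matrix sum.remove[of UNIV k] eq_neg_iff_add_eq_0)
    then have "(1 / c k) *\<^sub>R (c k *s (v $ {k} - v $ {})) =
        (1 / c k) *\<^sub>R (- (\<Sum>i\<in>UNIV-{k}. c i *s (v $ {i} - v $ {})))" by simp
    then have eq: "v $ {k} - v $ {} =
        (1 / c k) *\<^sub>R (- (\<Sum>i\<in>UNIV-{k}. c i *\<^sub>R (v $ {i} - v $ {})))"
      using ck by (simp add: scalar_mult_eq_scaleR)
    have "v $ {k} - v $ {} \<in> W"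
      unfolding eq
      by (intro subspace_scale[OF W] subspace_neg[OF W] subspace_sum[OF W])
        (auto simp: W_def memA)
    then have "v $ {k} \<in> A" by (auto simp: W_def)
    moreover have "v $ {k} \<in> P" unfolding P_def by (simp add: hull_inc)
    ultimately have "v $ {k} \<in> f F"
      using face_of_imp_eq_affine_Int[OF _ fF] by (auto simp: A_def P_def)
    then show False by (simp add: iff)
  qed
  then show ?thesis
    using matrix_left_invertible_independent_columns[of "edge_matrix v"]
    by (auto simp: invertible_left_inverse)
qed

lemma cube_realization_affine_normal_form:
  fixes v :: "(real^'n)^('n set)"
  assumes v: "v \<in> cube_realizations"
  shows "\<exists>!(A, b). invertible A \<and> (\<chi> S. A *v (v $ S) + b) \<in> cube_realization_space"
proof -
  define M where "M = edge_matrix v"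
  define p :: "real^'n" where "p = standard_cube $ {}"
  obtain N where N: "N ** M = mat 1" "M ** N = mat 1"
    using invertible_edge_matrix[OF v] by (auto simp: invertible_def M_def)
  have *: "invertible A \<and> (\<chi> S. A *v (v $ S) + b) \<in> cube_realization_space
     \<longleftrightarrow> A = N \<and> b = p - N *v (v $ {})" (is "?L \<longleftrightarrow> ?R") for A b
  proof
    assume L: ?L
    define w where "w = (\<chi> S. A *v (v $ S) + b)"
    have "edge_matrix w = edge_matrix standard_cube"
      using L by (simp add: edge_matrix_def cube_realization_space_def w_def)
    then have "A ** M = mat 1"
      by (simp add: w_def edge_matrix_affine_image edge_matrix_standard_cube M_def)
    then have "A = N"
      by (metis N(2) matrix_mul_assoc matrix_mul_lid matrix_mul_rid)
    moreover have "A *v (v $ {}) + b = p"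
      using L by (simp add: cube_realization_space_def p_def)
    ultimately show ?R by auto
  next
    assume R: ?R
    then have inv: "invertible A" using N by (auto simp: invertible_def)
    define w where "w = (\<chi> S. A *v (v $ S) + b)"
    have "edge_matrix w = edge_matrix standard_cube"
      using R N by (simp add: w_def edge_matrix_affine_image edge_matrix_standard_cube M_def)
    then have d: "w $ {i} - w $ {} = standard_cube $ {i} - standard_cube $ {}" for i
      by (metis column_edge_matrix)
    have w0: "w $ {} = standard_cube $ {}"
      using R by (simp add: w_def p_def)
    have "w $ {i} = standard_cube $ {i}" for i
      using d[of i] w0 by simp
    with w0 have "w \<in> cube_realization_space"
      using cube_realization_affine_image[OF v inv, of b]
      by (simp add: cube_realization_space_def w_def)
    then show ?L using inv by (simp add: w_def)
  qed
  show ?thesis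
    unfolding * by auto
qed

lemma cube_realizations_not_contractible:
  "\<not> contractible (cube_realizations :: ((real^'n)^('n set)) set)"
proof
  assume "contractible (cube_realizations :: ((real^'n)^('n set)) set)"
  then have "connected (cube_realizations :: ((real^'n)^('n set)) set)"
    by (rule contractible_imp_connected)
  moreover have "continuous_on cube_realizations (\<lambda>v :: (real^'n)^('n set). det (edge_matrix v))"
    unfolding det_def edge_matrix_def by (intro continuous_intros)
  ultimately have conn: "connected ((\<lambda>v :: (real^'n)^('n set). det (edge_matrix v)) ` cube_realizations)"
    (is "connected ?D") using connected_continuous_image by blast
  obtain k :: 'n where True by simp
  define R :: "real^'n^'n" where "R = (\<chi> i j. if i = j then (if i = k then -1 else 1) else 0)"
  have detR: "det R = -1"
  proof -
    have "det R = (\<Prod>i\<in>UNIV. if i = k then -1 else 1)"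
      by (subst det_diagonal) (auto simp: R_def)
    then show ?thesis by simp
  qed
  then have invR: "invertible R" by (simp add: invertible_det_nz)
  have std: "standard_cube \<in> (cube_realizations :: ((real^'n)^('n set)) set)"
    using standard_cube_realization by (auto simp: cube_realization_space_def)
  have "1 \<in> ?D"
    using std by (force simp: edge_matrix_standard_cube)
  moreover have "-1 \<in> ?D"
  proof
    show "(\<chi> S. R *v (standard_cube $ S) + 0) \<in> cube_realizations"
      by (rule cube_realization_affine_image[OF std invR])
    show "-1 = det (edge_matrix (\<chi> S. R *v (standard_cube $ S) + 0))"
      by (simp only: edge_matrix_affine_image edge_matrix_standard_cube matrix_mul_rid detR)
  qed
  ultimately have "0 \<in> ?D"
    using conn unfolding connected_iff_interval by force
  then obtain v :: "(real^'n)^('n set)" where "v \<in> cube_realizations" "det (edge_matrix v) = 0"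
    by auto
  then show False
    using invertible_edge_matrix invertible_det_nz by blast
qed

end

theory Submission
  imports Defs
begin

text \<open>Up to an affine map, a labelled combinatorial cube is \<open>{x. 0 \<le> x \<and> N x \<le> 1}\<close> for a
  matrix \<open>N\<close> with unit diagonal, and \<open>N\<close> depends continuously on the vertices and determines them
  continuously. Increasing a diagonal entry of \<open>N\<close> only slides vertices along edges, and scaling
  \<open>N\<close> is a dilation; hence the admissible matrices are starlike about the identity matrix, which
  represents the standard cube. This gives the strong deformation retraction.

  In terms of \<open>N\<close>, scaling rows by positive factors is a normal transformation and
  \<open>N \<mapsto> \<alpha> N + 1 w\<^sup>T\<close> is the projective transformation \<open>x \<mapsto> x / (w \<bullet> x + \<alpha>)\<close>. For every index
  \<open>p\<close>, a projective, a normal and a projective transformation clear the off-diagonal entries of column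
  \<open>p\<close> without spoiling the columns already cleared, so \<open>3 d\<close> steps lead from \<open>N\<close> to a
  diagonal matrix, and any two diagonal matrices represent normally equivalent boxes.\<close>

section \<open>Faces of labelled cubes\<close>

text \<open>The inequality \<open>a i e \<bullet> x \<le> \<beta> i e\<close> defines the facet whose vertices are the
  \<open>v S\<close> with \<open>(i \<in> S) = e\<close>.\<close>

definition cube_supports ::
    "('n::finite set \<Rightarrow> real^'n) \<Rightarrow> ('n \<Rightarrow> bool \<Rightarrow> real^'n) \<Rightarrow> ('n \<Rightarrow> bool \<Rightarrow> real) \<Rightarrow> bool" where
  "cube_supports v a \<beta> \<longleftrightarrow>
     (\<forall>S i. a i (i \<in> S) \<bullet> v S = \<beta> i (i \<in> S) \<and> a i (i \<notin> S) \<bullet> v S < \<beta> i (i \<notin> S))"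

lemma cube_supportsD:
  assumes "cube_supports v a \<beta>"
  shows "i \<in> T \<longleftrightarrow> e \<Longrightarrow> a i e \<bullet> v T = \<beta> i e"
    and "\<not> (i \<in> T \<longleftrightarrow> e) \<Longrightarrow> a i e \<bullet> v T < \<beta> i e"
proof -
  have "a i (i \<in> T) \<bullet> v T = \<beta> i (i \<in> T)" and "a i (i \<notin> T) \<bullet> v T < \<beta> i (i \<notin> T)"
    using assms unfolding cube_supports_def by blast+
  then show "i \<in> T \<longleftrightarrow> e \<Longrightarrow> a i e \<bullet> v T = \<beta> i e"
    and "\<not> (i \<in> T \<longleftrightarrow> e) \<Longrightarrow> a i e \<bullet> v T < \<beta> i e"
    by (cases e; simp)+
qed

lemma sum_UNIV_single:
  fixes f :: "'n::finite \<Rightarrow> 'a::comm_monoid_add"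
  assumes "\<And>k. k \<noteq> i \<Longrightarrow> f k = 0"
  shows "(\<Sum>k\<in>UNIV. f k) = f i"
  using assms by (subst sum.remove[of _ i]) (auto intro!: sum.neutral)

section \<open>Vertices, edges and normal cones\<close>

text \<open>The label of the neighbour of \<open>S\<close> along the edge in direction
  \<open>j\<close>.\<close>

definition flip :: "'n set \<Rightarrow> 'n \<Rightarrow> 'n set" where
  "flip S j = {i. (i \<in> S) \<noteq> (i = j)}"

text \<open>The labels \<open>S\<close> and \<open>flip S j\<close> differ only in \<open>j\<close>,
  so this edge stays on all facets through \<open>v S\<close> except the \<open>j\<close>-th, which
  it leaves inwards.\<close>

lemma supports_flip:
  assumes "cube_supports v a \<beta>"
  shows "i \<noteq> j \<Longrightarrow> a i (i \<in> S) \<bullet> (v (flip S j) - v S) = 0"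
    and "a j (j \<in> S) \<bullet> (v (flip S j) - v S) < 0"
proof -
  show "a i (i \<in> S) \<bullet> (v (flip S j) - v S) = 0" if "i \<noteq> j"
    using that cube_supportsD(1)[OF assms, of i "flip S j" "i \<in> S"] cube_supportsD(1)[OF assms, of i S]
    by (simp add: flip_def inner_diff_right)
  show "a j (j \<in> S) \<bullet> (v (flip S j) - v S) < 0"
    using cube_supportsD(2)[OF assms, of j "flip S j" "j \<in> S"] cube_supportsD(1)[OF assms, of j S]
    by (simp add: flip_def inner_diff_right)
qed

text \<open>Pairing the facet normals at a vertex with its edge directions gives a diagonal matrix
  with negative diagonal entries, so both families are bases.\<close>

lemma supports_invertible:
  assumes "cube_supports v a \<beta>"
  shows "invertible (\<chi> i. a i (i \<in> S))" and "invertible (\<chi> k j. (v (flip S j) - v S) $ k)"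
proof -
  let ?A = "\<chi> i. a i (i \<in> S)" and ?B = "\<chi> k j. (v (flip S j) - v S) $ k"
  have AB: "(?A ** ?B) $ i $ j = a i (i \<in> S) \<bullet> (v (flip S j) - v S)" for i j
    by (simp add: matrix_matrix_mult_def inner_vec_def)
  have "det (?A ** ?B) = (\<Prod>i\<in>UNIV. (?A ** ?B) $ i $ i)"
    by (rule det_diagonal) (simp only: AB supports_flip[OF assms] not_False_eq_True)
  also have "\<dots> \<noteq> 0"
    using supports_flip(2)[OF assms] by (simp only: AB) (simp add: less_le)
  finally show "invertible ?A" "invertible ?B"
    by (simp_all add: invertible_det_nz det_mul)
qed

text \<open>A functional that is maximal at \<open>v S\<close> lies in the normal cone there. The
  coefficients exist because the facet normals form a basis, and pairing with the
  \<open>j\<close>-th edge isolates the sign of \<open>l j\<close>.\<close>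

lemma supporting_functional:
  assumes sup: "cube_supports v a \<beta>" and S: "u \<bullet> v S = \<gamma>" and le: "\<And>T. u \<bullet> v T \<le> \<gamma>"
  obtains l where "\<And>i. 0 \<le> l i" "u = (\<Sum>i\<in>UNIV. l i *\<^sub>R a i (i \<in> S))"
proof -
  define A where "A = (\<chi> i. a i (i \<in> S))"
  have "invertible (transpose A)"
    using supports_invertible(1)[OF sup] by (simp add: A_def transpose_invertible)
  then obtain l where "transpose A *v l = u"
    by (metis invertible_def matrix_vector_mul_assoc matrix_vector_mul_lid)
  then have u: "u = (\<Sum>i\<in>UNIV. l $ i *\<^sub>R a i (i \<in> S))"
    by (auto simp: matrix_vector_mult_def transpose_def A_def vec_eq_iff mult.commute)
  have "0 \<le> l $ j" for j
  proof -
    have "u \<bullet> (v (flip S j) - v S) = (\<Sum>i\<in>UNIV. l $ i * (a i (i \<in> S) \<bullet> (v (flip S j) - v S)))"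
      by (subst u) (simp add: inner_sum_left)
    also have "\<dots> = l $ j * (a j (j \<in> S) \<bullet> (v (flip S j) - v S))"
      using supports_flip(1)[OF sup] by (intro sum_UNIV_single) simp
    finally have "l $ j * (a j (j \<in> S) \<bullet> (v (flip S j) - v S)) \<le> 0"
      using S le[of "flip S j"] by (simp add: inner_diff_right)
    with supports_flip(2)[OF sup] show ?thesis
      by (smt (verit) mult_neg_neg)
  qed
  with u show thesis by (rule that[rotated])
qed

text \<open>The drop of \<open>u\<close> from \<open>v S\<close> to \<open>v T\<close> is a
  nonnegative combination of the slacks of \<open>v T\<close> at the facets through
  \<open>v S\<close>. The slack at \<open>i\<close> vanishes exactly when \<open>S\<close> and
  \<open>T\<close> agree at \<open>i\<close>, so only the support of \<open>l\<close>
  matters.\<close>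

lemma supporting_functional_face:
  assumes sup: "cube_supports v a \<beta>" and l: "\<And>i. 0 \<le> l i"
    and u: "u = (\<Sum>i\<in>UNIV. l i *\<^sub>R a i (i \<in> S))"
  shows "u \<bullet> v T \<le> u \<bullet> v S" and "u \<bullet> v T = u \<bullet> v S \<longleftrightarrow> T \<inter> {i. l i \<noteq> 0} = S \<inter> {i. l i \<noteq> 0}"
proof -
  have diff: "u \<bullet> v S - u \<bullet> v T = (\<Sum>i\<in>UNIV. l i * (\<beta> i (i \<in> S) - a i (i \<in> S) \<bullet> v T))"
    using cube_supportsD(1)[OF sup]
    by (simp add: u inner_sum_left algebra_simps sum_subtractf)
  have nn: "0 \<le> \<beta> i (i \<in> S) - a i (i \<in> S) \<bullet> v T" for i
    using cube_supportsD[OF sup, of i T "i \<in> S"] by (cases "i \<in> T \<longleftrightarrow> i \<in> S") auto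
  have eq: "\<beta> i (i \<in> S) - a i (i \<in> S) \<bullet> v T = 0 \<longleftrightarrow> (i \<in> T \<longleftrightarrow> i \<in> S)" for i
    using cube_supportsD[OF sup, of i T "i \<in> S"] by (cases "i \<in> T \<longleftrightarrow> i \<in> S") auto
  have "0 \<le> u \<bullet> v S - u \<bullet> v T"
    unfolding diff by (intro sum_nonneg mult_nonneg_nonneg l nn)
  then show "u \<bullet> v T \<le> u \<bullet> v S" by simp
  have "u \<bullet> v T = u \<bullet> v S \<longleftrightarrow> u \<bullet> v S - u \<bullet> v T = 0" by auto
  also have "\<dots> \<longleftrightarrow> (\<forall>i. l i * (\<beta> i (i \<in> S) - a i (i \<in> S) \<bullet> v T) = 0)"
    unfolding diff by (subst sum_nonneg_eq_0_iff) (auto intro: mult_nonneg_nonneg l nn)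
  also have "\<dots> \<longleftrightarrow> T \<inter> {i. l i \<noteq> 0} = S \<inter> {i. l i \<noteq> 0}"
    unfolding mult_eq_0_iff eq by blast
  finally show "u \<bullet> v T = u \<bullet> v S \<longleftrightarrow> T \<inter> {i. l i \<noteq> 0} = S \<inter> {i. l i \<noteq> 0}" .
qed

section \<open>Faces as sets of labels\<close>

lemma inner_le_convex_hull:
  fixes u :: "'a::real_inner"
  assumes "\<And>x. x \<in> V \<Longrightarrow> u \<bullet> x \<le> c" and "y \<in> convex hull V"
  shows "u \<bullet> y \<le> c"
  using hull_minimal[of V "{x. u \<bullet> x \<le> c}" convex] assms by (auto simp: convex_halfspace_le)

lemma polytope_hull_range: "polytope (convex hull (range (v :: 'b::finite \<Rightarrow> 'a::euclidean_space)))"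
  by (intro polytope_convex_hull) simp

text \<open>Reduces the comparison of faces to that of their label sets.\<close>

lemma face_eq_hull_vertices:
  fixes v :: "'b::finite \<Rightarrow> 'a::euclidean_space"
  assumes F: "F face_of convex hull (range v)"
  shows "F = convex hull (v ` {S. v S \<in> F})"
proof
  obtain V where V: "V \<subseteq> range v" "F = convex hull V"
    by (rule face_of_convex_hull_subset[OF _ F]) (simp add: finite_imp_compact)
  then have "V \<subseteq> v ` {S. v S \<in> F}"
    using hull_subset[of V convex] by auto
  then show "F \<subseteq> convex hull (v ` {S. v S \<in> F})"
    using hull_mono[of V "v ` {S. v S \<in> F}" convex] V(2) by simp
  show "convex hull (v ` {S. v S \<in> F}) \<subseteq> F"
    using F by (intro hull_minimal) (auto simp: face_of_imp_convex)
qed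

text \<open>Label sets of the nonempty faces of the unit cube: \<open>J\<close> holds the fixed
  coordinates and \<open>S\<close> their values. The empty face has no counterpart here and is
  treated separately.\<close>

definition subcubes :: "'n set set set" where
  "subcubes = {{T. T \<inter> J = S \<inter> J} | S J. True}"

text \<open>Faces of a polytope are exposed. The exposing functional lies in the normal cone of any
  vertex on the face, and the support of its coefficients serves as \<open>J\<close>.\<close>

lemma supports_face_labels:
  assumes sup: "cube_supports v a \<beta>" and F: "F face_of convex hull (range v)" "F \<noteq> {}"
  shows "{S. v S \<in> F} \<in> subcubes"
proof -
  have "F exposed_face_of convex hull (range v)"
    using F(1) exposed_face_of_polyhedron polytope_imp_polyhedron polytope_hull_range by blast
  then obtain u \<gamma> where u: "convex hull (range v) \<subseteq> {x. u \<bullet> x \<le> \<gamma>}"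
    and Fu: "F = convex hull (range v) \<inter> {x. u \<bullet> x = \<gamma>}"
    by (auto simp: exposed_face_of_def)
  have mem: "v T \<in> convex hull (range v)" for T
    by (simp add: hull_inc)
  obtain S where "v S \<in> F"
    using face_eq_hull_vertices[OF F(1)] F(2)
    by (metis (no_types, lifting) Collect_empty_eq convex_hull_eq_empty image_is_empty)
  then have uS: "u \<bullet> v S = \<gamma>" by (simp add: Fu)
  obtain l where l: "\<And>i. 0 \<le> l i" "u = (\<Sum>i\<in>UNIV. l i *\<^sub>R a i (i \<in> S))"
    using supporting_functional[OF sup uS] u mem by blast
  have "{T. v T \<in> F} = {T. u \<bullet> v T = u \<bullet> v S}"
    using mem by (auto simp: Fu uS)
  also have "\<dots> = {T. T \<inter> {i. l i \<noteq> 0} = S \<inter> {i. l i \<noteq> 0}}"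
    unfolding supporting_functional_face(2)[OF sup l] ..
  finally show ?thesis by (auto simp: subcubes_def)
qed

text \<open>The sum of the normals of the facets that fix the coordinates in \<open>J\<close>
  exposes the required face.\<close>

lemma supports_subcube_face:
  assumes sup: "cube_supports v a \<beta>" and L: "L \<in> subcubes"
  obtains F where "F face_of convex hull (range v)" "{S. v S \<in> F} = L"
proof -
  obtain S J where LSJ: "L = {T. T \<inter> J = S \<inter> J}"
    using L by (auto simp: subcubes_def)
  define l :: "'a \<Rightarrow> real" where "l i = (if i \<in> J then 1 else 0)" for i
  define u where "u = (\<Sum>i\<in>UNIV. l i *\<^sub>R a i (i \<in> S))"
  have l: "0 \<le> l i" for i by (simp add: l_def)
  have J: "{i. l i \<noteq> 0} = J" by (auto simp: l_def)
  note face = supporting_functional_face[OF sup l u_def, unfolded J]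
  define F where "F = convex hull (range v) \<inter> {x. u \<bullet> x = u \<bullet> v S}"
  show thesis
  proof
    show "F face_of convex hull (range v)"
      unfolding F_def using face(1)
      by (intro face_of_Int_supporting_hyperplane_le convex_convex_hull)
        (erule inner_le_convex_hull[rotated], auto)
    show "{S. v S \<in> F} = L"
      using face(2) by (auto simp: F_def LSJ hull_inc)
  qed
qed

lemma face_subset_iff_labels:
  fixes v :: "'b::finite \<Rightarrow> 'a::euclidean_space"
  assumes "F face_of convex hull (range v)" "G face_of convex hull (range v)"
  shows "F \<subseteq> G \<longleftrightarrow> {S. v S \<in> F} \<subseteq> {S. v S \<in> G}"
proof
  assume "{S. v S \<in> F} \<subseteq> {S. v S \<in> G}"
  then have "convex hull (v ` {S. v S \<in> F}) \<subseteq> convex hull (v ` {S. v S \<in> G})"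
    by (intro hull_mono image_mono)
  then show "F \<subseteq> G"
    using face_eq_hull_vertices[OF assms(1)] face_eq_hull_vertices[OF assms(2)] by simp
qed auto

lemma supports_inj:
  assumes "cube_supports v a \<beta>"
  shows "inj v"
proof
  fix S T assume "v S = v T"
  then have "i \<in> S \<longleftrightarrow> i \<in> T" for i
    using cube_supportsD(1)[OF assms, of i S "i \<in> S"] cube_supportsD(2)[OF assms, of i T "i \<in> S"]
    by fastforce
  then show "S = T" by blast
qed

lemma supports_vertex_face:
  assumes sup: "cube_supports v a \<beta>"
  shows "{v S} face_of convex hull (range v)"
proof -
  have "{S} = {T. T \<inter> UNIV = S \<inter> UNIV}" by auto
  then have "{S} \<in> subcubes" unfolding subcubes_def by blast
  then obtain F where F: "F face_of convex hull (range v)" "{S. v S \<in> F} = {S}"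
    by (rule supports_subcube_face[OF sup])
  then have "F = {v S}"
    using face_eq_hull_vertices[OF F(1)] by simp
  with F(1) show ?thesis by simp
qed

text \<open>Both face lattices are \<open>subcubes\<close> together with the empty face, ordered by
  inclusion of labels, so matching label sets is an isomorphism.\<close>

lemma supports_face_lattice_iso:
  assumes v: "cube_supports v a \<beta>" and w: "cube_supports w a' \<beta>'"
  obtains f where "face_lattice_iso f (convex hull (range v)) (convex hull (range w))"
    "\<And>S. f {v S} = {w S}"
proof
  define f where "f F = convex hull (w ` {S. v S \<in> F})" for F
  have img: "f F face_of convex hull (range w) \<and> {S. w S \<in> f F} = {S. v S \<in> F}"
    if F: "F face_of convex hull (range v)" for F
  proof (cases "F = {}")
    case False
    obtain G where G: "G face_of convex hull (range w)" "{S. w S \<in> G} = {S. v S \<in> F}"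
      using supports_subcube_face[OF w supports_face_labels[OF v F False]] .
    moreover have "f F = G"
      using face_eq_hull_vertices[OF G(1)] by (simp add: f_def G(2))
    ultimately show ?thesis by simp
  qed (simp add: f_def)
  have ord: "F \<subseteq> G \<longleftrightarrow> f F \<subseteq> f G"
    if "F face_of convex hull (range v)" "G face_of convex hull (range v)" for F G
    using that img by (simp add: face_subset_iff_labels[of _ v] face_subset_iff_labels[of _ w])
  have surj: "\<exists>F. F face_of convex hull (range v) \<and> f F = G"
    if G: "G face_of convex hull (range w)" for G
  proof (cases "G = {}")
    case True
    then show ?thesis by (intro exI[of _ "{}"]) (simp add: f_def)
  next
    case False
    obtain F where F: "F face_of convex hull (range v)" "{S. v S \<in> F} = {S. w S \<in> G}"
      using supports_subcube_face[OF v supports_face_labels[OF w G False]] .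
    then have "f F = G"
      using face_eq_hull_vertices[OF G] by (simp add: f_def)
    with F(1) show ?thesis by blast
  qed
  show "face_lattice_iso f (convex hull (range v)) (convex hull (range w))"
    unfolding face_lattice_iso_def
  proof (intro conjI allI impI)
    show "bij_betw f {F. F face_of convex hull (range v)} {G. G face_of convex hull (range w)}"
    proof (rule bij_betw_imageI)
      show "inj_on f {F. F face_of convex hull (range v)}"
        by (rule inj_onI) (use ord in auto)
      show "f ` {F. F face_of convex hull (range v)} = {G. G face_of convex hull (range w)}"
        using img surj by blast
    qed
  qed (simp add: ord)
  show "f {v S} = {w S}" for S
    using supports_inj[OF v] by (simp add: f_def inj_eq)
qed

lemma hull_cube_vertex: "convex hull (range cube_vertex) = cbox (0::real^'n) 1"
proof -
  have "x \<in> range cube_vertex" if "\<forall>i. x $ i = 0 \<or> x $ i = 1" for x :: "real^'n"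
  proof
    show "x = cube_vertex {i. x $ i = 1}"
      using that by (auto simp: cube_vertex_def vec_eq_iff)
  qed simp
  then have "range (cube_vertex :: 'n set \<Rightarrow> real^'n) = {x. \<forall>i. x $ i = 0 \<or> x $ i = 1}"
    by (auto simp: cube_vertex_def)
  then show ?thesis
    unfolding Cart_1 unit_interval_convex_hull by (simp add: Basis_vec_def inner_axis)
qed

lemma supports_cube_vertex:
  "cube_supports (cube_vertex :: 'n set \<Rightarrow> real^'n)
     (\<lambda>i e. if e then axis i 1 else - axis i 1) (\<lambda>i e. if e then 1 else 0)"
  by (auto simp: cube_supports_def cube_vertex_def inner_axis')

text \<open>The edge directions at \<open>v {}\<close> already span the space.\<close>

lemma supports_aff_dim:
  fixes v :: "'n::finite set \<Rightarrow> real^'n"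
  assumes sup: "cube_supports v a \<beta>"
  shows "aff_dim (convex hull (range v)) = int CARD('n)"
proof -
  define B where "B = (\<chi> k j. (v (flip {} j) - v {}) $ k)"
  have "columns B = range (\<lambda>j. v (flip {} j) - v {})"
    by (auto simp: columns_def column_def B_def vec_eq_iff image_def)
  then have "columns B \<subseteq> (\<lambda>x. x - v {}) ` range v" by auto
  moreover have "vec.span (columns B) = UNIV"
    using supports_invertible(2)[OF sup, of "{}"] matrix_right_invertible_span_columns[of B]
    by (auto simp: B_def invertible_def)
  then have "span (columns B) = UNIV" by (simp add: span_vec_eq)
  ultimately have "span ((\<lambda>x. x - v {}) ` range v) = UNIV"
    using span_mono[of "columns B"] by auto
  then have "dim ((\<lambda>x. x - v {}) ` range v) = CARD('n)"
    by (metis dim_UNIV dim_span DIM_cart DIM_real mult.right_neutral)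
  then show ?thesis
    using aff_dim_eq_dim_subtract[of "v {}" "range v"] by (simp add: hull_inc aff_dim_convex_hull)
qed

section \<open>Realizations and supporting systems\<close>

text \<open>Trades the abstract lattice isomorphism for linear inequalities. An isomorphism carries
  the facets of the unit cube to faces of the hull, and functionals exposing these supply
  \<open>a\<close> and \<open>\<beta>\<close>.\<close>

lemma cube_realizations_iff_supports:
  fixes v :: "(real^'n)^('n set)"
  shows "v \<in> cube_realizations \<longleftrightarrow> (\<exists>a \<beta>. cube_supports (($) v) a \<beta>)"
proof
  assume "\<exists>a \<beta>. cube_supports (($) v) a \<beta>"
  then obtain a \<beta> where sup: "cube_supports (($) v) a \<beta>" by blast
  obtain f where "face_lattice_iso f (cbox 0 1) (convex hull (range (($) v)))"
    "\<And>S. f {cube_vertex S} = {v $ S}"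
    using supports_face_lattice_iso[OF supports_cube_vertex sup] unfolding hull_cube_vertex by blast
  then show "v \<in> cube_realizations"
    using supports_aff_dim[OF sup] polytope_hull_range
    by (auto simp: cube_realizations_def d_polytope_def)
next
  assume "v \<in> cube_realizations"
  then obtain f where f: "face_lattice_iso f (cbox 0 1) (convex hull (range (($) v)))"
    and fv: "\<And>S. f {cube_vertex S} = {v $ S}"
    by (auto simp: cube_realizations_def)
  have "\<exists>u \<gamma>. \<forall>S. ((i \<in> S) = e \<longrightarrow> u \<bullet> v $ S = \<gamma>) \<and> ((i \<in> S) \<noteq> e \<longrightarrow> u \<bullet> v $ S < \<gamma>)" for i e
  proof -
    define c :: real where "c = (if e then 1 else 0)"
    define F where "F = cbox (0::real^'n) 1 \<inter> {x. axis i 1 \<bullet> x = c}"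
    have F: "F face_of cbox 0 1"
    proof (cases e)
      case True
      then show ?thesis unfolding F_def c_def
        by (intro face_of_Int_supporting_hyperplane_le) (auto simp: mem_box_cart inner_axis')
    next
      case False
      then show ?thesis unfolding F_def c_def
        by (intro face_of_Int_supporting_hyperplane_ge) (auto simp: mem_box_cart inner_axis')
    qed
    have vface: "{cube_vertex S} face_of cbox (0::real^'n) 1" for S
      using supports_vertex_face[OF supports_cube_vertex] by (simp add: hull_cube_vertex)
    have inF: "{cube_vertex S} \<subseteq> F \<longleftrightarrow> (i \<in> S) = e" for S
      by (auto simp: F_def c_def cube_vertex_def mem_box_cart inner_axis')
    have iff: "v $ S \<in> f F \<longleftrightarrow> (i \<in> S) = e" for S
      using f vface[of S] F inF[of S] fv[of S] by (auto simp: face_lattice_iso_def)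
    have "f F face_of convex hull (range (($) v))"
      using f F by (auto simp: face_lattice_iso_def bij_betw_def)
    then have "f F exposed_face_of convex hull (range (($) v))"
      using exposed_face_of_polyhedron polytope_imp_polyhedron polytope_hull_range by blast
    then obtain u \<gamma> where u: "convex hull (range (($) v)) \<subseteq> {x. u \<bullet> x \<le> \<gamma>}"
      and Fu: "f F = convex hull (range (($) v)) \<inter> {x. u \<bullet> x = \<gamma>}"
      by (auto simp: exposed_face_of_def)
    have mem: "v $ S \<in> convex hull (range (($) v))" for S
      by (simp add: hull_inc)
    have "u \<bullet> v $ S \<le> \<gamma>" "u \<bullet> v $ S = \<gamma> \<longleftrightarrow> (i \<in> S) = e" for S
      using iff[of S] u mem[of S] by (auto simp: Fu)
    then show ?thesis by (intro exI[of _ u] exI[of _ \<gamma>]) (auto simp: less_le)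
  qed
  then obtain a \<beta> where "\<And>i e S. (i \<in> S) = e \<Longrightarrow> a i e \<bullet> v $ S = \<beta> i e"
      "\<And>i e S. (i \<in> S) \<noteq> e \<Longrightarrow> a i e \<bullet> v $ S < \<beta> i e"
    by metis
  then have "cube_supports (($) v) a \<beta>"
    by (simp add: cube_supports_def)
  then show "\<exists>a \<beta>. cube_supports (($) v) a \<beta>" by blast
qed

lemma combinatorial_cube_realization:
  assumes "v \<in> cube_realizations"
  shows "combinatorial_cube (convex hull (range (($) v)))"
  using assms by (auto simp: cube_realizations_def combinatorial_cube_def combinatorially_equivalent_def)

text \<open>A lattice isomorphism preserves minimal nonempty faces, hence it labels the vertices of
  \<open>Q\<close>, and \<open>Q\<close> is the hull of its extreme points.\<close>

lemma combinatorial_cube_obtain_realization: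
  fixes Q :: "(real^'n) set"
  assumes "combinatorial_cube Q"
  obtains v where "v \<in> cube_realizations" "Q = convex hull (range (($) v))"
proof -
  obtain f where Q: "d_polytope Q" and f: "face_lattice_iso f (cbox 0 1) Q"
    using assms by (auto simp: combinatorial_cube_def combinatorially_equivalent_def)
  have QP: "polytope Q" "compact Q" "convex Q"
    using Q by (auto simp: d_polytope_def polytope_imp_compact polytope_imp_convex)
  let ?C = "cbox (0::real^'n) 1"
  have ff: "f F face_of Q" if "F face_of ?C" for F
    using f that by (auto simp: face_lattice_iso_def bij_betw_def)
  have ford: "F \<subseteq> G \<longleftrightarrow> f F \<subseteq> f G" if "F face_of ?C" "G face_of ?C" for F G
    using f that by (auto simp: face_lattice_iso_def)
  have fsurj: "\<exists>F. F face_of ?C \<and> f F = G" if "G face_of Q" for G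
    using f that unfolding face_lattice_iso_def bij_betw_def by (metis (mono_tags) imageE mem_Collect_eq)
  have f0: "f F = {} \<longleftrightarrow> F = {}" if F: "F face_of ?C" for F
  proof -
    obtain F0 where F0: "F0 face_of ?C" "f F0 = {}"
      using fsurj[OF empty_face_of] by blast
    then have "F0 = {}" using ford[OF F0(1) empty_face_of] by auto
    with F0 show ?thesis using ford[OF F, of "{}"] by auto
  qed
  have vface: "{cube_vertex S} face_of ?C" for S
    using supports_vertex_face[OF supports_cube_vertex] by (simp add: hull_cube_vertex)
  \<comment> \<open>An extreme point of the image face gives a face of \<open>Q\<close>. Its
    preimage is nonempty and contained in the singleton, hence equal to it.\<close>
  have sing: "\<exists>x. f {cube_vertex S} = {x}" for S
  proof -
    have face: "f {cube_vertex S} face_of Q" using ff vface by blast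
    have "compact (f {cube_vertex S})" "convex (f {cube_vertex S})"
      using face QP face_of_imp_compact face_of_imp_convex by blast+
    then obtain x where "x extreme_point_of f {cube_vertex S}"
      using extreme_point_exists_convex f0[OF vface] by (metis insert_not_empty)
    then have x: "{x} face_of f {cube_vertex S}" by (simp add: face_of_singleton)
    then obtain F where F: "F face_of ?C" "f F = {x}"
      using fsurj face face_of_trans by blast
    then have "F \<subseteq> {cube_vertex S}"
      using ford[OF F(1) vface] face_of_imp_subset[OF x] by simp
    moreover have "F \<noteq> {}" using f0[OF F(1)] F(2) by auto
    ultimately show ?thesis using F(2) by (metis subset_singletonD)
  qed
  then obtain w where w: "\<And>S. f {cube_vertex S} = {w S}" by metis
  define v :: "(real^'n)^('n set)" where "v = (\<chi> S. w S)"
  have v: "($) v = w" by (auto simp: v_def)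
  \<comment> \<open>Every vertex of \<open>Q\<close> receives a label: the preimage of its singleton
    contains a vertex of the unit cube.\<close>
  have "{x. x extreme_point_of Q} = range w"
  proof (intro equalityI subsetI)
    fix x assume "x \<in> {x. x extreme_point_of Q}"
    then have "{x} face_of Q" by (simp add: face_of_singleton)
    then obtain F where F: "F face_of ?C" "f F = {x}" using fsurj by blast
    have "compact F" "convex F"
      using F(1) face_of_imp_compact[OF _ _ F(1)] face_of_imp_convex by auto
    moreover have "F \<noteq> {}" using f0[OF F(1)] F(2) by auto
    ultimately obtain y where "y extreme_point_of F"
      using extreme_point_exists_convex by blast
    then have y: "{y} face_of F" by (simp add: face_of_singleton)
    then have "y extreme_point_of convex hull (range cube_vertex)"
      using face_of_trans[OF y F(1)] by (simp add: face_of_singleton hull_cube_vertex)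
    then obtain S where S: "y = cube_vertex S"
      using extreme_point_of_convex_hull by blast
    have "f {cube_vertex S} \<subseteq> f F"
      using ford[OF vface F(1)] face_of_imp_subset[OF y] S by blast
    then show "x \<in> range w" by (auto simp: w F(2))
  next
    fix x assume "x \<in> range w"
    then show "x \<in> {x. x extreme_point_of Q}"
      using ff[OF vface] by (auto simp: w face_of_singleton)
  qed
  then have hull: "Q = convex hull (range (($) v))"
    using Krein_Milman_Minkowski[OF QP(2,3)] by (simp add: v)
  have "v \<in> cube_realizations"
    unfolding cube_realizations_def mem_Collect_eq hull[symmetric]
    using Q f w by (auto simp: v_def)
  then show thesis using hull that by blast
qed

section \<open>Facets and facet normals\<close>

text \<open>Facets are maximal among the proper faces, and the maximal proper subcubes are those
  that fix a single coordinate.\<close>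

lemma supports_facet_iff:
  assumes sup: "cube_supports v a \<beta>"
  shows "F facet_of convex hull (range v) \<longleftrightarrow>
    F face_of convex hull (range v) \<and> (\<exists>i e. {S. v S \<in> F} = {S. (i \<in> S) = e})"
proof -
  let ?P = "convex hull (range v)"
  have half: "{S. (i \<in> S) = e} \<in> subcubes" for i :: 'a and e
  proof -
    have "{S. (i \<in> S) = e} = {T. T \<inter> {i} = (if e then {i} else {}) \<inter> {i}}" by auto
    then show ?thesis unfolding subcubes_def by blast
  qed
  \<comment> \<open>The dimension of a larger proper face would lie strictly between two consecutive
    integers.\<close>
  have maximal: "G = F" if F: "F facet_of ?P" and G: "G face_of ?P" "F \<subseteq> G" "G \<noteq> ?P" for F G
  proof (rule ccontr)
    assume "G \<noteq> F"
    have "F face_of G"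
      by (rule face_of_subset[OF facet_of_imp_face_of[OF F] G(2) face_of_imp_subset[OF G(1)]])
    then have "aff_dim F < aff_dim G"
      using \<open>G \<noteq> F\<close> face_of_imp_convex[OF G(1)] face_of_aff_dim_lt by metis
    moreover have "aff_dim G < aff_dim ?P"
      using G by (intro face_of_aff_dim_lt) auto
    ultimately show False using F by (simp add: facet_of_def)
  qed
  have lab: "\<exists>i e. {S. v S \<in> F} = {S. (i \<in> S) = e}" if F: "F facet_of ?P" for F
  proof -
    have "{S. v S \<in> F} \<in> subcubes"
      using supports_face_labels[OF sup] F by (auto simp: facet_of_def)
    then obtain S J where SJ: "{T. v T \<in> F} = {T. T \<inter> J = S \<inter> J}"
      by (auto simp: subcubes_def)
    have Fne: "F \<noteq> ?P" using F facet_of_irrefl by blast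
    have "J \<noteq> {}"
    proof
      assume "J = {}"
      then have "{T. v T \<in> F} = UNIV" unfolding SJ by simp
      then show False
        using Fne face_eq_hull_vertices[of F v] F by (simp add: facet_of_def)
    qed
    then obtain i where i: "i \<in> J" by blast
    obtain G where G: "G face_of ?P" "{T. v T \<in> G} = {T. (i \<in> T) = (i \<in> S)}"
      using supports_subcube_face[OF sup half] .
    have "{T. v T \<in> F} \<subseteq> {T. v T \<in> G}"
      unfolding SJ G(2) using i by blast
    then have "F \<subseteq> G"
      using face_subset_iff_labels[OF facet_of_imp_face_of[OF F] G(1)] by blast
    moreover have "flip S i \<notin> {T. v T \<in> G}"
      unfolding G(2) by (simp add: flip_def)
    then have "v (flip S i) \<notin> G" by simp
    then have "G \<noteq> ?P" by (metis hull_inc rangeI)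
    ultimately show ?thesis using maximal[OF F G(1)] G(2) by blast
  qed
  show ?thesis
  proof
    assume "F facet_of ?P"
    then show "F face_of ?P \<and> (\<exists>i e. {S. v S \<in> F} = {S. (i \<in> S) = e})"
      using lab facet_of_imp_face_of by blast
  next
    assume "F face_of ?P \<and> (\<exists>i e. {S. v S \<in> F} = {S. (i \<in> S) = e})"
    then obtain i e where F: "F face_of ?P" "{S. v S \<in> F} = {S. (i \<in> S) = e}" by blast
    have "(if e then {i} else {}) \<in> {S. v S \<in> F}" "(if e then {} else {i}) \<notin> {S. v S \<in> F}"
      unfolding F(2) by simp_all
    then have "F \<noteq> {}" "F \<noteq> ?P"
      by (auto simp: hull_inc split: if_splits)
    then obtain G where G: "G facet_of ?P" "F \<subseteq> G"
      using face_of_polyhedron_subset_facet[OF _ F(1)] polytope_imp_polyhedron polytope_hull_range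
      by blast
    obtain j e' where je: "{S. v S \<in> G} = {S. (j \<in> S) = e'}" using lab[OF G(1)] by blast
    have "{S. (i \<in> S) = e} \<subseteq> {S. (j \<in> S) = e'}"
      using face_subset_iff_labels[OF F(1) facet_of_imp_face_of[OF G(1)]] G(2) F(2) je by simp
    then have sub: "(i \<in> S) = e \<Longrightarrow> (j \<in> S) = e'" for S by blast
    \<comment> \<open>Suitable test labels show that one half of the cube contains another only if
      the two coincide.\<close>
    have "j = i"
    proof (rule ccontr)
      assume "j \<noteq> i"
      then show False
        using sub[of "{i}"] sub[of "{i, j}"] sub[of "{}"] sub[of "{j}"] by (cases e) simp_all
    qed
    moreover have "e' = e"
      using sub[of "{i}"] sub[of "{}"] \<open>j = i\<close> by (cases e) simp_all
    ultimately have "F = G"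
      using je F face_eq_hull_vertices[OF F(1)] face_eq_hull_vertices[OF facet_of_imp_face_of[OF G(1)]] by simp
    with G(1) show "F facet_of ?P" by simp
  qed
qed

lemma supports_nonzero:
  assumes "cube_supports v a \<beta>"
  shows "a i e \<noteq> 0"
  using cube_supportsD(1)[OF assms, of i "if e then {i} else {}" e]
    cube_supportsD(2)[OF assms, of i "if e then {} else {i}" e] by (cases e) auto

text \<open>Reduces normal equivalence to comparing the directions of the \<open>a i e\<close>. An
  outer normal of a facet lies in the normal cone at one of its vertices, and moving along an edge
  inside the facet kills every coefficient but that of the facet itself.\<close>

lemma facet_normals_supports:
  assumes sup: "cube_supports v a \<beta>"
  shows "facet_normals (convex hull (range v)) = {sgn (a i e) | i e. True}"
proof (intro equalityI subsetI)
  let ?P = "convex hull (range v)"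
  have mem: "v S \<in> ?P" for S by (simp add: hull_inc)
  {
    fix u assume "u \<in> facet_normals ?P"
    then obtain F \<gamma> where u: "norm u = 1" "F facet_of ?P" "\<And>x. x \<in> ?P \<Longrightarrow> u \<bullet> x \<le> \<gamma>"
      and F: "F = ?P \<inter> {x. u \<bullet> x = \<gamma>}"
      by (auto simp: facet_normals_def)
    obtain i e where ie: "{S. v S \<in> F} = {S. (i \<in> S) = e}"
      using u(2) supports_facet_iff[OF sup] by blast
    have iff: "u \<bullet> v S = \<gamma> \<longleftrightarrow> (i \<in> S) = e" for S
      using ie mem by (auto simp: F)
    define S where "S = (if e then {i} else {})"
    have S: "u \<bullet> v S = \<gamma>" and iS: "(i \<in> S) = e" unfolding iff by (auto simp: S_def)
    obtain l where l: "\<And>i. 0 \<le> l i" "u = (\<Sum>i\<in>UNIV. l i *\<^sub>R a i (i \<in> S))"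
      using supporting_functional[OF sup S] u(3) mem by blast
    have "l j = 0" if "j \<noteq> i" for j
    proof -
      have "u \<bullet> v (flip S j) = u \<bullet> v S"
        unfolding S iff using that by (auto simp: flip_def S_def)
      then have "flip S j \<inter> {i. l i \<noteq> 0} = S \<inter> {i. l i \<noteq> 0}"
        using supporting_functional_face(2)[OF sup l] by blast
      then show ?thesis by (auto simp: flip_def)
    qed
    then have "u = l i *\<^sub>R a i e"
      using l(2) sum_UNIV_single[of i "\<lambda>j. l j *\<^sub>R a j (j \<in> S)"] by (simp add: iS)
    moreover from this have "0 < l i" using u(1) l(1)[of i] by (cases "l i = 0") auto
    ultimately have "sgn u = sgn (a i e)" by (simp add: sgn_scaleR)
    with u(1) show "u \<in> {sgn (a i e) | i e. True}"
      by (auto simp: sgn_div_norm)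
  next
    fix u assume "u \<in> {sgn (a i e) | i e. True}"
    then obtain i e where u: "u = sgn (a i e)" by blast
    define k where "k = inverse (norm (a i e))"
    have k: "0 < k" and uk: "u = k *\<^sub>R a i e"
      using supports_nonzero[OF sup] by (auto simp: k_def u sgn_div_norm)
    have sgn1: "norm u = 1" using supports_nonzero[OF sup] by (simp add: u norm_sgn)
    define F where "F = ?P \<inter> {x. u \<bullet> x = k * \<beta> i e}"
    have eq: "u \<bullet> v S = k * \<beta> i e \<longleftrightarrow> (i \<in> S) = e" for S
      using cube_supportsD[OF sup, of i S e] k by (cases "(i \<in> S) = e") (simp_all add: uk)
    have le: "u \<bullet> v S \<le> k * \<beta> i e" for S
      using cube_supportsD[OF sup, of i S e] k by (cases "(i \<in> S) = e") (simp_all add: uk)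
    have le': "u \<bullet> x \<le> k * \<beta> i e" if "x \<in> ?P" for x
      by (rule inner_le_convex_hull[OF _ that]) (use le in auto)
    have "F face_of ?P"
      unfolding F_def by (intro face_of_Int_supporting_hyperplane_le) (auto intro: le')
    moreover have "{S. v S \<in> F} = {S. (i \<in> S) = e}"
      using eq mem by (auto simp: F_def)
    ultimately have "F facet_of ?P"
      using supports_facet_iff[OF sup] by blast
    then show "u \<in> facet_normals ?P"
      unfolding facet_normals_def using sgn1 le' F_def by blast
  }
qed

section \<open>Projective transformations\<close>

text \<open>Homogeneous coordinates; \<open>None\<close> indexes the additional coordinate as in
  \<open>projective_matrix\<close>, so projective maps become linear up to a scalar.\<close>

definition homogenize :: "real^'n \<Rightarrow> real^('n option)" where
  "homogenize x = (\<chi> i. case i of Some j \<Rightarrow> x $ j | None \<Rightarrow> 1)"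

lemma sum_UNIV_option:
  "(\<Sum>i\<in>(UNIV :: 'n::finite option set). f i) = f None + (\<Sum>i\<in>UNIV. f (Some i))"
proof -
  have "(\<Sum>i\<in>(UNIV :: 'n option set). f i) = f None + (\<Sum>i\<in>range Some. f i)"
    unfolding UNIV_option_conv by (subst sum.insert) auto
  also have "(\<Sum>i\<in>range Some. f i) = (\<Sum>i\<in>UNIV. f (Some i))"
    by (subst sum.reindex) auto
  finally show ?thesis .
qed

lemma projective_matrix_mult:
  fixes X :: "real^('n::finite option)"
  shows "(projective_matrix A b c \<alpha> *v X) $ Some i = (A *v (\<chi> j. X $ Some j)) $ i + b $ i * X $ None"
    and "(projective_matrix A b c \<alpha> *v X) $ None = c \<bullet> (\<chi> j. X $ Some j) + \<alpha> * X $ None"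
  by (simp_all add: matrix_vector_mult_def sum_UNIV_option projective_matrix_def inner_vec_def)

lemma projective_matrix_homogenize:
  assumes "c \<bullet> x + \<alpha> \<noteq> 0"
  shows "projective_matrix A b c \<alpha> *v homogenize x
    = (c \<bullet> x + \<alpha>) *\<^sub>R homogenize (projective_map A b c \<alpha> x)"
proof -
  have "(\<chi> j. homogenize x $ Some j) = x" "homogenize x $ None = 1"
    by (simp_all add: homogenize_def vec_eq_iff)
  moreover have "i = None \<or> (\<exists>j. i = Some j)" for i :: "'a option" by (cases i) auto
  ultimately show ?thesis
    using assms
    by (auto simp: vec_eq_iff projective_matrix_mult homogenize_def projective_map_def
        split: option.splits)
qed

text \<open>Allows the inverse of a projective matrix to be read as projective data again.\<close>

lemma projective_matrix_surj: "\<exists>A b c \<alpha>. M = projective_matrix A b c \<alpha>"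
proof -
  have "M = projective_matrix (\<chi> i j. M $ Some i $ Some j) (\<chi> i. M $ Some i $ None)
     (\<chi> j. M $ None $ Some j) (M $ None $ None)"
    by (auto simp: projective_matrix_def vec_eq_iff split: option.splits)
  then show ?thesis by blast
qed

text \<open>The inverse matrix induces the inverse map, because homogeneous vectors are mapped
  linearly up to the denominator.\<close>

lemma projectively_equivalent_sym:
  assumes "projectively_equivalent P Q"
  shows "projectively_equivalent Q P"
proof -
  obtain A b c \<alpha> where det: "det (projective_matrix A b c \<alpha>) \<noteq> 0"
    and nz: "\<And>x. x \<in> P \<Longrightarrow> c \<bullet> x + \<alpha> \<noteq> 0" and Q: "Q = projective_map A b c \<alpha> ` P"
    using assms by (auto simp: projectively_equivalent_def)
  define M where "M = projective_matrix A b c \<alpha>"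
  obtain M' where M': "M' ** M = mat 1" "M ** M' = mat 1"
    using det by (auto simp: M_def invertible_det_nz[symmetric] invertible_def)
  obtain A' b' c' \<alpha>' where eq: "M' = projective_matrix A' b' c' \<alpha>'"
    using projective_matrix_surj by blast
  have inv: "c' \<bullet> y + \<alpha>' \<noteq> 0 \<and> projective_map A' b' c' \<alpha>' y = x"
    if x: "x \<in> P" and y: "y = projective_map A b c \<alpha> x" for x y
  proof -
    define d where "d = c \<bullet> x + \<alpha>"
    have d: "d \<noteq> 0" using nz[OF x] by (simp add: d_def)
    have "M *v homogenize x = d *\<^sub>R homogenize y"
      using projective_matrix_homogenize[OF nz[OF x]] by (simp add: M_def d_def y)
    then have "homogenize x = M' *v (d *\<^sub>R homogenize y)"
      by (metis M'(1) matrix_vector_mul_assoc matrix_vector_mul_lid)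
    then have h: "homogenize x = d *\<^sub>R (M' *v homogenize y)"
      by (simp add: matrix_vector_mult_scaleR)
    have hy: "(\<chi> j. homogenize y $ Some j) = y" "homogenize y $ None = 1"
      by (simp_all add: homogenize_def vec_eq_iff)
    \<comment> \<open>The \<open>None\<close> coordinate says that the two denominators are
      reciprocal, so the inverse map has no pole on \<open>Q\<close>.\<close>
    have one: "d * (c' \<bullet> y + \<alpha>') = 1"
      using arg_cong[OF h, of "\<lambda>z. z $ None"]
      by (simp add: eq projective_matrix_mult hy) (simp add: homogenize_def)
    then have d': "inverse (c' \<bullet> y + \<alpha>') = d" "c' \<bullet> y + \<alpha>' \<noteq> 0"
      by (metis inverse_unique mult.commute, metis mult_zero_right zero_neq_one)
    have "x $ i = d * ((A' *v y) $ i + b' $ i)" for i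
      using arg_cong[OF h, of "\<lambda>z. z $ Some i"]
      by (simp add: eq projective_matrix_mult hy) (simp add: homogenize_def)
    then show ?thesis
      using d' by (simp add: projective_map_def vec_eq_iff)
  qed
  have "det M' \<noteq> 0"
    using M' by (metis det_I det_mul mult_zero_left zero_neq_one)
  moreover have "projective_map A' b' c' \<alpha>' ` Q = P"
    unfolding Q image_image using inv by simp
  moreover have "\<forall>y\<in>Q. c' \<bullet> y + \<alpha>' \<noteq> 0"
    unfolding Q using inv by blast
  ultimately show ?thesis
    unfolding projectively_equivalent_def eq by blast
qed

lemma projective_matrix_det_nonzero:
  assumes "\<And>x t. A *v x + t *\<^sub>R b = 0 \<Longrightarrow> c \<bullet> x + \<alpha> * t = 0 \<Longrightarrow> x = 0 \<and> t = 0"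
  shows "det (projective_matrix A b c \<alpha>) \<noteq> 0"
proof -
  have "X = 0" if X: "projective_matrix A b c \<alpha> *v X = 0" for X
  proof -
    define x where "x = (\<chi> j. X $ Some j)"
    have "A *v x + X $ None *\<^sub>R b = 0"
      using arg_cong[OF X, of "\<lambda>z. z $ Some _"]
      by (simp add: projective_matrix_mult x_def vec_eq_iff mult.commute)
    moreover have "c \<bullet> x + \<alpha> * X $ None = 0"
      using arg_cong[OF X, of "\<lambda>z. z $ None"] by (simp add: projective_matrix_mult x_def)
    ultimately have "x = 0" and None: "X $ None = 0" using assms by blast+
    from \<open>x = 0\<close> have "X $ Some j = 0" for j
      by (simp add: x_def vec_eq_iff)
    with None have "X $ i = 0" for i by (cases i) auto
    then show ?thesis by (simp add: vec_eq_iff)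
  qed
  then have "inj ((*v) (projective_matrix A b c \<alpha>))"
    by (intro linear_injective_0[THEN iffD2]) auto
  then show ?thesis
    unfolding invertible_det_nz[symmetric] invertible_left_inverse matrix_left_invertible_injective .
qed

lemma affine_image_projectively_equivalent:
  assumes "invertible A"
  shows "projectively_equivalent P ((\<lambda>x. A *v x + b) ` P)"
proof -
  have "x = 0" if "A *v x = 0" for x
    using assms that by (metis invertible_def matrix_vector_mul_assoc matrix_vector_mul_lid matrix_vector_mult_0_right)
  then have "det (projective_matrix A b 0 1) \<noteq> 0"
    by (intro projective_matrix_det_nonzero) auto
  then show ?thesis
    unfolding projectively_equivalent_def
    by (intro exI[of _ A] exI[of _ b] exI[of _ 0] exI[of _ 1]) (auto simp: projective_map_def)
qed

section \<open>Perspectivities\<close>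

text \<open>The image of a convex combination is a convex combination of the images, with weights
  multiplied by the denominators and renormalised. Hence the points satisfying both claims form a
  convex set.\<close>

lemma perspective_hull_subset:
  fixes w :: "'a::real_inner"
  assumes V: "\<And>x. x \<in> V \<Longrightarrow> 0 < w \<bullet> x + \<alpha>" and x: "x \<in> convex hull V"
  shows "0 < w \<bullet> x + \<alpha>" and "x /\<^sub>R (w \<bullet> x + \<alpha>) \<in> convex hull ((\<lambda>x. x /\<^sub>R (w \<bullet> x + \<alpha>)) ` V)"
proof -
  define f where "f = (\<lambda>x. x /\<^sub>R (w \<bullet> x + \<alpha>))"
  define Y where "Y = {x. 0 < w \<bullet> x + \<alpha> \<and> f x \<in> convex hull (f ` V)}"
  have "convex Y"
  proof (rule convexI)
    fix x y and u v :: real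
    assume x: "x \<in> Y" and y: "y \<in> Y" and uv: "0 \<le> u" "0 \<le> v" "u + v = 1"
    define dx dy d where "dx = w \<bullet> x + \<alpha>" and "dy = w \<bullet> y + \<alpha>" and "d = u * dx + v * dy"
    have d: "0 < dx" "0 < dy" using x y by (auto simp: Y_def dx_def dy_def)
    then have d0: "0 < d"
      using uv unfolding d_def by (cases "u = 0") (auto intro: add_pos_nonneg)
    have deq: "w \<bullet> (u *\<^sub>R x + v *\<^sub>R y) + \<alpha> = d"
    proof -
      have "d = u * (w \<bullet> x) + v * (w \<bullet> y) + (u + v) * \<alpha>"
        by (simp add: d_def dx_def dy_def algebra_simps)
      with uv(3) show ?thesis by (simp add: inner_add_right)
    qed
    have "f (u *\<^sub>R x + v *\<^sub>R y) = (u * dx / d) *\<^sub>R f x + (v * dy / d) *\<^sub>R f y"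
    proof -
      have "u * dx / d * inverse dx = inverse d * u" "v * dy / d * inverse dy = inverse d * v"
        using d by (simp_all add: field_simps)
      then show ?thesis
        unfolding f_def deq dx_def[symmetric] dy_def[symmetric] scaleR_add_right scaleR_scaleR
        by simp
    qed
    moreover have "u * dx / d + v * dy / d = 1"
      using d0 by (simp add: d_def add_divide_distrib[symmetric])
    ultimately have "f (u *\<^sub>R x + v *\<^sub>R y) \<in> convex hull (f ` V)"
      using x y uv d d0 by (auto simp: Y_def intro!: convexD[OF convex_convex_hull])
    then show "u *\<^sub>R x + v *\<^sub>R y \<in> Y"
      using d0 deq by (simp add: Y_def)
  qed
  moreover have "V \<subseteq> Y"
    using V by (auto simp: Y_def hull_inc)
  ultimately have "x \<in> Y"
    using x hull_minimal[of V Y convex] by blast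
  then show "0 < w \<bullet> x + \<alpha>" and "x /\<^sub>R (w \<bullet> x + \<alpha>) \<in> convex hull ((\<lambda>x. x /\<^sub>R (w \<bullet> x + \<alpha>)) ` V)"
    by (auto simp: Y_def f_def)
qed

text \<open>The inverse map has the same form, with vector \<open>w'\<close> and constant
  \<open>inverse \<alpha>\<close>, so both inclusions between the hulls come from the same
  lemma.\<close>

lemma perspective_projectively_equivalent:
  fixes w :: "real^'n"
  assumes \<alpha>: "0 < \<alpha>" and V: "\<And>x. x \<in> V \<Longrightarrow> 0 < w \<bullet> x + \<alpha>"
  shows "projectively_equivalent (convex hull V) (convex hull ((\<lambda>x. x /\<^sub>R (w \<bullet> x + \<alpha>)) ` V))"
proof -
  define f where "f = (\<lambda>x. x /\<^sub>R (w \<bullet> x + \<alpha>))"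
  define w' where "w' = (- inverse \<alpha>) *\<^sub>R w"
  define g where "g = (\<lambda>y. y /\<^sub>R (w' \<bullet> y + inverse \<alpha>))"
  have den: "w' \<bullet> f x + inverse \<alpha> = inverse (w \<bullet> x + \<alpha>)" if "0 < w \<bullet> x + \<alpha>" for x
  proof -
    define e where "e = w \<bullet> x + \<alpha>"
    have "w' \<bullet> f x = - (inverse \<alpha> * (inverse e * (e - \<alpha>)))"
      by (simp add: w'_def f_def e_def)
    moreover have "0 < e" using that by (simp add: e_def)
    ultimately show ?thesis
      unfolding e_def[symmetric] using \<alpha> by (simp add: field_simps)
  qed
  have gf: "g (f x) = x" if "0 < w \<bullet> x + \<alpha>" for x
    unfolding g_def den[OF that] using that by (simp add: f_def)
  have den2: "w \<bullet> g y + \<alpha> = inverse (w' \<bullet> y + inverse \<alpha>)" if "0 < w' \<bullet> y + inverse \<alpha>" for y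
  proof -
    define e where "e = w' \<bullet> y + inverse \<alpha>"
    have "w \<bullet> y = 1 - \<alpha> * e" using \<alpha> by (simp add: e_def w'_def field_simps)
    then have "w \<bullet> g y = inverse e * (1 - \<alpha> * e)" by (simp add: g_def e_def)
    moreover have "0 < e" using that by (simp add: e_def)
    ultimately show ?thesis
      unfolding e_def[symmetric] by (simp add: field_simps)
  qed
  have fg: "f (g y) = y" if "0 < w' \<bullet> y + inverse \<alpha>" for y
    unfolding f_def den2[OF that] using that by (simp add: g_def)
  have "f ` (convex hull V) = convex hull (f ` V)"
  proof (intro equalityI subsetI)
    fix y assume "y \<in> f ` (convex hull V)"
    then show "y \<in> convex hull (f ` V)"
      using perspective_hull_subset(2)[of V w \<alpha>] V by (auto simp: f_def)
  next
    fix y assume y: "y \<in> convex hull (f ` V)"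
    have pos: "0 < w' \<bullet> z + inverse \<alpha>" if "z \<in> f ` V" for z
    proof -
      obtain x where "x \<in> V" "z = f x" using \<open>z \<in> f ` V\<close> by blast
      then show ?thesis using den[OF V] V by simp
    qed
    have "g y \<in> convex hull (g ` f ` V)"
      using perspective_hull_subset(2)[OF _ y, of w' "inverse \<alpha>"] pos by (simp add: g_def)
    also have "g ` f ` V = V"
      unfolding image_image using V gf by simp
    finally have "g y \<in> convex hull V" .
    moreover have "f (g y) = y"
      by (rule fg, rule perspective_hull_subset(1)[OF _ y], rule pos)
    ultimately show "y \<in> f ` (convex hull V)"
      by (metis imageI)
  qed
  moreover have "f = projective_map (mat 1) 0 w \<alpha>"
    by (auto simp: f_def projective_map_def)
  moreover have "det (projective_matrix (mat 1) 0 w \<alpha>) \<noteq> 0"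
    using \<alpha> by (intro projective_matrix_det_nonzero) auto
  moreover have "w \<bullet> x + \<alpha> \<noteq> 0" if "x \<in> convex hull V" for x
    using perspective_hull_subset(1)[OF V that] by simp
  ultimately show ?thesis
    unfolding projectively_equivalent_def f_def[symmetric]
    by (intro exI[of _ "mat 1"] exI[of _ 0] exI[of _ w] exI[of _ \<alpha>]) simp
qed

section \<open>Cubes given by matrices\<close>

text \<open>The matrix \<open>N\<close> stands for the polytope \<open>{x. 0 \<le> x \<and> N x \<le> 1}\<close>: the vertex labelled
  \<open>S\<close> lies on the facets \<open>(N x)\<^sub>i = 1\<close> for \<open>i \<in> S\<close> and \<open>x\<^sub>i = 0\<close> for \<open>i \<notin> S\<close>.\<close>

definition is_cube_vertex :: "real^'n^'n \<Rightarrow> 'n set \<Rightarrow> real^'n \<Rightarrow> bool" where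
  "is_cube_vertex N S x \<longleftrightarrow>
     (\<forall>i\<in>S. 0 < x $ i \<and> (N *v x) $ i = 1) \<and> (\<forall>i\<in>-S. x $ i = 0 \<and> (N *v x) $ i < 1)"

definition cube_matrix :: "real^'n^'n \<Rightarrow> bool" where
  "cube_matrix N \<longleftrightarrow> (\<forall>S. \<exists>x. is_cube_vertex N S x)"

text \<open>The facets through the vertex \<open>S\<close>, written with outward normals so that the
  rows are those of the supporting system; the matching right-hand side is
  \<open>cube_vertex S\<close>.\<close>

definition vertex_system :: "real^'n^'n \<Rightarrow> 'n set \<Rightarrow> real^'n^'n" where
  "vertex_system N S = (\<chi> i. if i \<in> S then N $ i else - axis i 1)"

text \<open>Cramer's rule for \<open>vertex_system N S *v x = cube_vertex S\<close>. The explicit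
  quotient gives continuity in \<open>N\<close>; it is meaningful where the determinant is nonzero,
  in particular for a \<open>cube_matrix\<close>.\<close>

definition vertex :: "real^'n^'n \<Rightarrow> 'n set \<Rightarrow> real^'n" where
  "vertex N S = (\<chi> k. det (\<chi> i j. if j = k then cube_vertex S $ i else vertex_system N S $ i $ j)
     / det (vertex_system N S))"

definition cube_of :: "real^'n^'n \<Rightarrow> (real^'n) set" where
  "cube_of N = convex hull (range (vertex N))"

lemma is_cube_vertex_supports:
  assumes "\<And>S. is_cube_vertex N S (v S)"
  shows "cube_supports v (\<lambda>i e. if e then N $ i else - axis i 1) (\<lambda>i e. if e then 1 else 0)"
  using assms by (auto simp: is_cube_vertex_def cube_supports_def inner_axis' matrix_vector_mul_component)

lemma is_cube_vertex_system:
  assumes "is_cube_vertex N S x"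
  shows "vertex_system N S *v x = cube_vertex S"
proof -
  have "(vertex_system N S *v x) $ i = cube_vertex S $ i" for i
    using assms unfolding is_cube_vertex_def
    by (cases "i \<in> S") (auto simp: vertex_system_def matrix_vector_mul_component cube_vertex_def inner_axis')
  then show ?thesis by (simp add: vec_eq_iff)
qed

lemma cube_matrix_det_vertex_system:
  assumes "cube_matrix N"
  shows "det (vertex_system N S) \<noteq> 0"
proof -
  obtain v where "\<And>S. is_cube_vertex N S (v S)"
    using assms by (metis cube_matrix_def)
  from supports_invertible(1)[OF is_cube_vertex_supports[OF this], of S]
  have "invertible (vertex_system N S)"
    by (simp add: vertex_system_def)
  then show ?thesis by (simp add: invertible_det_nz)
qed

lemma is_cube_vertex_iff:
  assumes "cube_matrix N"
  shows "is_cube_vertex N S x \<longleftrightarrow> x = vertex N S"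
proof -
  have uniq: "y = vertex N S" if "is_cube_vertex N S y" for y
    using is_cube_vertex_system[OF that] cramer[OF cube_matrix_det_vertex_system[OF assms]]
    by (simp add: vertex_def)
  with assms show ?thesis by (metis cube_matrix_def)
qed

lemma is_cube_vertex_vertex: "cube_matrix N \<Longrightarrow> is_cube_vertex N S (vertex N S)"
  by (simp add: is_cube_vertex_iff)

lemma vertexD:
  assumes "cube_matrix N"
  shows "i \<in> S \<Longrightarrow> 0 < vertex N S $ i" "i \<in> S \<Longrightarrow> (N *v vertex N S) $ i = 1"
    "i \<notin> S \<Longrightarrow> vertex N S $ i = 0" "i \<notin> S \<Longrightarrow> (N *v vertex N S) $ i < 1"
  using is_cube_vertex_vertex[OF assms, of S] by (auto simp: is_cube_vertex_def)

lemma cube_matrix_realization: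
  assumes "cube_matrix N"
  shows "(\<chi> S. vertex N S) \<in> cube_realizations"
proof -
  have "($) (\<chi> S. vertex N S) = vertex N" by auto
  then show ?thesis
    using is_cube_vertex_supports[of N "vertex N"] is_cube_vertex_vertex[OF assms]
    by (auto simp: cube_realizations_iff_supports)
qed

lemma combinatorial_cube_cube_of:
  assumes "cube_matrix N"
  shows "combinatorial_cube (cube_of N)"
proof -
  have "($) (\<chi> S. vertex N S) = vertex N" by auto
  then show ?thesis
    using combinatorial_cube_realization[OF cube_matrix_realization[OF assms]]
    by (simp add: cube_of_def)
qed

text \<open>The facet normals are the normalised rows and the vectors \<open>- axis i 1\<close>;
  positive row factors change neither.\<close>

lemma normally_equivalent_row_scaling:
  assumes N: "cube_matrix N" "cube_matrix N'" and d: "\<And>i. 0 < d i" "\<And>i. N' $ i = d i *\<^sub>R N $ i"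
  shows "normally_equivalent (cube_of N) (cube_of N')"
proof -
  have normals: "facet_normals (cube_of M)
      = {sgn (if e then M $ i else - axis i 1) | i e. True}" if "cube_matrix M" for M :: "real^'a^'a"
    unfolding cube_of_def
    using facet_normals_supports[OF is_cube_vertex_supports[OF is_cube_vertex_vertex[OF that]]] .
  have "sgn (if e then N' $ i else - axis i 1) = sgn (if e then N $ i else - axis i 1)" for i e
    using d(1)[of i] by (simp add: d(2) sgn_scaleR)
  then show ?thesis
    by (simp add: normally_equivalent_def normals[OF N(1)] normals[OF N(2)])
qed

text \<open>The perspectivity with denominator \<open>w \<bullet> x + \<alpha>\<close> preserves
  each hyperplane \<open>x\<^sub>i = 0\<close> and sends \<open>(N x)\<^sub>i = 1\<close> to
  \<open>(w + \<alpha> N\<^sub>i) \<bullet> y = 1\<close>. Positive denominators preserve the strict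
  inequalities, so labels persist.\<close>

lemma cube_matrix_perspective:
  assumes N: "cube_matrix N" and \<alpha>: "0 < \<alpha>" and pos: "\<And>S. 0 < w \<bullet> vertex N S + \<alpha>"
  defines "N' \<equiv> \<chi> i. w + \<alpha> *\<^sub>R N $ i"
  shows "cube_matrix N'" and "projectively_equivalent (cube_of N) (cube_of N')"
proof -
  define f where "f = (\<lambda>x. x /\<^sub>R (w \<bullet> x + \<alpha>))"
  have vert: "is_cube_vertex N' S (f (vertex N S))" for S
  proof -
    define x d where "x = vertex N S" and "d = w \<bullet> x + \<alpha>"
    have d: "0 < d" using pos[of S] by (simp add: d_def x_def)
    have N'x: "(N' *v f x) $ i = (w \<bullet> x + \<alpha> * (N *v x) $ i) / d" for i
      by (simp add: N'_def f_def d_def[symmetric] matrix_vector_mul_component inner_add_left divide_inverse mult.commute)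
    show ?thesis
      unfolding is_cube_vertex_def x_def[symmetric]
    proof (intro conjI ballI)
      fix i assume "i \<in> S"
      then show "0 < f x $ i" "(N' *v f x) $ i = 1"
        unfolding N'x using vertexD[OF N, of i S] d by (simp_all add: f_def x_def d_def)
    next
      fix i assume "i \<in> - S"
      then show "f x $ i = 0" "(N' *v f x) $ i < 1"
        unfolding N'x using vertexD[OF N, of i S] d \<alpha> by (simp_all add: f_def x_def d_def)
    qed
  qed
  then show N': "cube_matrix N'" by (auto simp: cube_matrix_def)
  have "range (vertex N') = f ` range (vertex N)"
    using vert by (simp add: is_cube_vertex_iff[OF N'] image_image)
  then show "projectively_equivalent (cube_of N) (cube_of N')"
    using perspective_projectively_equivalent[OF \<alpha>, of "range (vertex N)" w] pos
    by (auto simp: cube_of_def f_def)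
qed

text \<open>The change of coordinates
  \<open>x\<^sub>k \<mapsto> x\<^sub>k / c\<^sub>k\<close>.\<close>

lemma cube_matrix_column_scaling:
  assumes N: "cube_matrix N" and c: "\<And>k. 0 < c k"
  shows "cube_matrix (\<chi> i k. N $ i $ k * c k)"
  unfolding cube_matrix_def
proof
  fix S
  have "((\<chi> i k. N $ i $ k * c k) *v (\<chi> k. vertex N S $ k / c k)) $ i = (N *v vertex N S) $ i" for i
    using c by (simp add: matrix_vector_mult_def less_imp_neq[THEN not_sym])
  then have "is_cube_vertex (\<chi> i k. N $ i $ k * c k) S (\<chi> k. vertex N S $ k / c k)"
    using vertexD[OF N, of _ S] c by (simp add: is_cube_vertex_def)
  then show "\<exists>x. is_cube_vertex (\<chi> i k. N $ i $ k * c k) S x" by blast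
qed

text \<open>The candidate vertices solve linear systems and depend continuously on the row factors;
  the finitely many strict inequalities persist near the limit.\<close>

lemma eventually_cube_matrix_row_scaling:
  fixes K :: "real^'n^'n"
  assumes K: "cube_matrix K" and d: "\<And>i. ((\<lambda>t. d t i) \<longlongrightarrow> 1) F"
  shows "\<forall>\<^sub>F t in F. cube_matrix (\<chi> i. d t i *\<^sub>R K $ i)"
proof -
  have "\<forall>\<^sub>F t in F. \<exists>x. is_cube_vertex (\<chi> i. d t i *\<^sub>R K $ i) S x" for S
  proof -
    obtain B where B: "B ** vertex_system K S = mat 1" "vertex_system K S ** B = mat 1"
      using cube_matrix_det_vertex_system[OF K] invertible_det_nz invertible_def by metis
    \<comment> \<open>Scaling row \<open>i\<close> by \<open>d t i\<close> amounts to the right-hand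
      side \<open>1 / d t i\<close> for the unscaled row, so the single inverse \<open>B\<close>
      serves for all \<open>t\<close>.\<close>
    define b :: "_ \<Rightarrow> real^'n" where "b t = (\<chi> i. if i \<in> S then 1 / d t i else 0)" for t
    define x where "x t = B *v b t" for t
    have sys: "vertex_system K S *v x t = b t" for t
      by (simp add: x_def matrix_vector_mul_assoc B)
    have xK: "(K *v x t) $ i = 1 / d t i" if "i \<in> S" for i t
      using that arg_cong[OF sys[of t], of "\<lambda>z. z $ i"]
      by (simp add: vertex_system_def b_def matrix_vector_mul_component)
    have x0: "x t $ i = 0" if "i \<notin> S" for i t
      using that arg_cong[OF sys[of t], of "\<lambda>z. z $ i"]
      by (simp add: vertex_system_def b_def matrix_vector_mul_component inner_axis')
    have "(b \<longlongrightarrow> cube_vertex S) F"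
      unfolding b_def cube_vertex_def
    proof (rule tendsto_vec_lambda)
      fix i
      show "((\<lambda>t. if i \<in> S then 1 / d t i else 0) \<longlongrightarrow> (if i \<in> S then 1 else 0)) F"
        using tendsto_divide[OF tendsto_const[of 1] d[of i]] by simp
    qed
    then have "(x \<longlongrightarrow> B *v cube_vertex S) F"
      unfolding x_def matrix_vector_mult_def by (intro tendsto_intros)
    also have "B *v cube_vertex S = vertex K S"
      using is_cube_vertex_system[OF is_cube_vertex_vertex[OF K]] B(1)
      by (metis matrix_vector_mul_assoc matrix_vector_mul_lid)
    finally have lim: "(x \<longlongrightarrow> vertex K S) F" .
    have "\<forall>\<^sub>F t in F. 0 < d t i" for i
      using order_tendstoD(1)[OF d[of i], of 0] by simp
    moreover have "\<forall>\<^sub>F t in F. i \<in> S \<longrightarrow> 0 < x t $ i" for i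
      using order_tendstoD(1)[OF tendsto_vec_nth[OF lim, of i], of 0] vertexD(1)[OF K, of i S]
      by (cases "i \<in> S") auto
    moreover have "\<forall>\<^sub>F t in F. i \<notin> S \<longrightarrow> d t i * (K *v x t) $ i < 1" for i
    proof -
      have "((\<lambda>t. d t i * (K *v x t) $ i) \<longlongrightarrow> 1 * (K *v vertex K S) $ i) F"
        unfolding matrix_vector_mul_component by (intro tendsto_intros d lim)
      then show ?thesis
        using order_tendstoD(2)[of _ "(K *v vertex K S) $ i" F 1] vertexD(4)[OF K, of i S]
        by (cases "i \<in> S") auto
    qed
    ultimately have "\<forall>\<^sub>F t in F. \<forall>i. 0 < d t i \<and> (i \<in> S \<longrightarrow> 0 < x t $ i) \<and>
        (i \<notin> S \<longrightarrow> d t i * (K *v x t) $ i < 1)"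
      by (intro eventually_all_finite eventually_conj)
    then show ?thesis
    proof eventually_elim
      case (elim t)
      have "((\<chi> i. d t i *\<^sub>R K $ i) *v x t) $ i = d t i * (K *v x t) $ i" for i
        by (simp add: matrix_vector_mul_component)
      then have "is_cube_vertex (\<chi> i. d t i *\<^sub>R K $ i) S (x t)"
        using elim xK x0 by (auto simp: is_cube_vertex_def less_imp_neq[THEN not_sym])
      then show ?case by blast
    qed
  qed
  then show ?thesis
    unfolding cube_matrix_def by (intro eventually_all_finite)
qed

section \<open>Eliminating columns\<close>

text \<open>\<open>K\<close> is a prism with height coordinate \<open>p\<close>. Its base is the
  facet \<open>x\<^sub>p = 0\<close> after the perspectivity \<open>x / (1 - (N x)\<^sub>p)\<close>,
  which sends the opposite facet to infinity.\<close>

lemma cube_matrix_prism: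
  fixes N :: "real^'n^'n" and p :: 'n
  assumes N: "cube_matrix N"
  defines "K \<equiv> \<chi> j k. if j = p \<or> k = p then (if j = k then 1 else 0) else N $ j $ k - N $ p $ k"
  shows "cube_matrix K"
  unfolding cube_matrix_def
proof
  fix S
  define x where "x = vertex N (S - {p})"
  define E where "E = 1 - (N *v x) $ p"
  note x = vertexD[OF N, of _ "S - {p}", folded x_def]
  have E: "0 < E" using x(4)[of p] by (simp add: E_def)
  have xp: "x $ p = 0" using x(3) by simp
  \<comment> \<open>The base point comes from the label \<open>S - {p}\<close>; membership of
    \<open>p\<close> in \<open>S\<close> decides between bottom and top.\<close>
  define y where "y = x /\<^sub>R E + (if p \<in> S then axis p 1 else 0)"
  have yp: "y $ p = (if p \<in> S then 1 else 0)" by (simp add: y_def xp axis_def)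
  have yk: "y $ k = x $ k / E" if "k \<noteq> p" for k
    using that by (simp add: y_def axis_def divide_inverse)
  have Kp: "(K *v y) $ p = y $ p"
    using sum_UNIV_single[of p "\<lambda>k. K $ p $ k * y $ k"] by (simp add: matrix_vector_mult_def K_def)
  have Kj: "(K *v y) $ j = ((N *v x) $ j - 1) / E + 1" if "j \<noteq> p" for j
  proof -
    have "(K *v y) $ j = (\<Sum>k\<in>UNIV. (N $ j $ k * x $ k - N $ p $ k * x $ k) / E)"
      unfolding matrix_vector_mult_def
      using that xp yk by (auto simp: K_def diff_divide_distrib algebra_simps intro!: sum.cong)
    also have "\<dots> = ((N *v x) $ j - (N *v x) $ p) / E"
      by (simp add: matrix_vector_mult_def sum_subtractf flip: sum_divide_distrib)
    also have "\<dots> = ((N *v x) $ j - 1) / E + 1"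
      using E by (simp add: E_def field_simps)
    finally show ?thesis .
  qed
  have "is_cube_vertex K S y"
    unfolding is_cube_vertex_def
  proof (intro conjI ballI)
    fix i assume i: "i \<in> S"
    show "0 < y $ i"
      using i x(1)[of i] E by (cases "i = p") (simp_all add: yp yk)
    show "(K *v y) $ i = 1"
      using i x(2)[of i] by (cases "i = p") (simp_all add: Kp yp Kj)
  next
    fix i assume i: "i \<in> - S"
    show "y $ i = 0"
      using i x(3)[of i] by (cases "i = p") (simp_all add: yp yk)
    show "(K *v y) $ i < 1"
      using i x(4)[of i] E by (cases "i = p") (simp_all add: Kp yp Kj divide_neg_pos)
  qed
  then show "\<exists>y. is_cube_vertex K S y" by blast
qed

definition cube_step :: "(real^'n) set \<Rightarrow> (real^'n) set \<Rightarrow> bool" where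
  "cube_step P Q \<longleftrightarrow> combinatorial_cube P \<and> combinatorial_cube Q \<and>
     (projectively_equivalent P Q \<or> normally_equivalent P Q)"

lemma cube_step_sym: "cube_step P Q \<Longrightarrow> cube_step Q P"
  using projectively_equivalent_sym by (auto simp: cube_step_def normally_equivalent_def)

lemma cube_steps_sym: "(cube_step ^^ n) P Q \<Longrightarrow> (cube_step ^^ n) Q P"
proof (induction n arbitrary: P)
  case (Suc n)
  then obtain R where "cube_step P R" "(cube_step ^^ n) R Q" by (meson relpowp_Suc_E2)
  then show ?case using Suc.IH cube_step_sym by (auto intro: relpowp_Suc_I)
qed simp

text \<open>Sending to infinity a hyperplane of the pencil of the facets \<open>x\<^sub>p = 0\<close> and
  \<open>(N x)\<^sub>p = 1\<close> makes them parallel. As \<open>\<delta> \<rightarrow> 0\<close> that hyperplane approaches the facet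
  \<open>x\<^sub>p = 0\<close>; the remaining facets can then be translated until all of them meet the two parallel
  ones in proportional positions, and a second projective transformation turns the polytope into a
  prism over its facet \<open>x\<^sub>p = 0\<close>.\<close>

lemma eliminate_column:
  fixes N :: "real^'n^'n"
  assumes N: "cube_matrix N"
  obtains N' where "cube_matrix N'" "(cube_step ^^ 3) (cube_of N) (cube_of N')"
    "\<And>k j. k = p \<or> (\<forall>i. i \<noteq> k \<longrightarrow> N $ i $ k = 0) \<Longrightarrow> j \<noteq> k \<Longrightarrow> N' $ j $ k = 0"
proof -
  define K :: "real^'n^'n" where
    "K = (\<chi> j k. if j = p \<or> k = p then (if j = k then 1 else 0) else N $ j $ k - N $ p $ k)"
  \<comment> \<open>The entry in row \<open>j\<close> and column \<open>p\<close> of the matrix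
    \<open>N1\<close> below; it tends to one as \<open>\<delta>\<close> tends to zero.\<close>
  define b where "b \<delta> j = 1 + \<delta> * (N $ j $ p - N $ p $ p)" for \<delta> :: real and j
  have K: "cube_matrix K" unfolding K_def by (rule cube_matrix_prism[OF N])
  have blim: "((\<lambda>\<delta>. b \<delta> j) \<longlongrightarrow> 1) (at_right 0)" for j
  proof -
    have "((\<lambda>\<delta>. b \<delta> j) \<longlongrightarrow> 1 + 0 * (N $ j $ p - N $ p $ p)) (at_right 0)"
      unfolding b_def by (intro tendsto_intros)
    then show ?thesis by simp
  qed
  have "\<forall>\<^sub>F \<delta> in at_right 0. cube_matrix (\<chi> j. (1 / b \<delta> j) *\<^sub>R K $ j)"
  proof (rule eventually_cube_matrix_row_scaling[OF K])
    show "((\<lambda>\<delta>. 1 / b \<delta> j) \<longlongrightarrow> 1) (at_right 0)" for j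
      using tendsto_divide[OF tendsto_const[of 1] blim[of j]] by simp
  qed
  moreover have "\<forall>\<^sub>F \<delta> in at_right 0. \<forall>j. 0 < b \<delta> j"
    using order_tendstoD(1)[OF blim, of 0] by (intro eventually_all_finite) simp
  moreover have "\<forall>\<^sub>F \<delta> in at_right 0. 0 < (\<delta>::real)"
    by (simp add: eventually_at_right_less)
  ultimately have "\<forall>\<^sub>F \<delta> in at_right 0. 0 < \<delta> \<and> (\<forall>j. 0 < b \<delta> j) \<and>
      cube_matrix (\<chi> j. (1 / b \<delta> j) *\<^sub>R K $ j)"
    by eventually_elim blast
  then obtain \<delta> where \<delta>: "0 < \<delta>" "\<And>j. 0 < b \<delta> j" "cube_matrix (\<chi> j. (1 / b \<delta> j) *\<^sub>R K $ j)"
    using eventually_happens' trivial_limit_at_right_real by blast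
  have bp: "b \<delta> p = 1" by (simp add: b_def)
  \<comment> \<open>The denominator becomes \<open>x\<^sub>p + \<delta> (1 - (N x)\<^sub>p)\<close>,
    a positive combination of the slacks of two opposite facets, which never vanish together at a
    vertex.\<close>
  define w1 where "w1 = axis p 1 - \<delta> *\<^sub>R N $ p"
  define N1 where "N1 = (\<chi> j. w1 + \<delta> *\<^sub>R N $ j)"
  have pos1: "0 < w1 \<bullet> vertex N S + \<delta>" for S
  proof -
    have "w1 \<bullet> vertex N S + \<delta> = vertex N S $ p + \<delta> * (1 - (N *v vertex N S) $ p)"
      by (simp add: w1_def inner_diff_left inner_axis' matrix_vector_mul_component algebra_simps)
    also have "\<dots> > 0"
      using vertexD[OF N, of p S] \<delta>(1) by (cases "p \<in> S") simp_all
    finally show ?thesis .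
  qed
  note step1 = cube_matrix_perspective[OF N \<delta>(1) pos1, folded N1_def]
  \<comment> \<open>These factors are chosen so that adding one half to column \<open>p\<close> of
    \<open>N3\<close> produces a row scaling of \<open>N1\<close>.\<close>
  define c where "c k = (if k = p then 1/2 else \<delta>/2)" for k
  define N3 where "N3 = (\<chi> j k. (\<chi> j. (1 / b \<delta> j) *\<^sub>R K $ j) $ j $ k * c k)"
  have N3: "cube_matrix N3"
    unfolding N3_def using \<delta>(1) by (intro cube_matrix_column_scaling \<delta>(3)) (simp add: c_def)
  have N3_nth: "N3 $ j $ k = (if j = p \<or> k = p then (if j = k then 1/2 else 0)
      else \<delta> * (N $ j $ k - N $ p $ k) / (2 * b \<delta> j))" for j k
    by (auto simp: N3_def K_def c_def bp field_simps)
  \<comment> \<open>This perspectivity alters column \<open>p\<close> only. It leads from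
    \<open>N3\<close> to \<open>N2\<close> and is traversed backwards in the chain.\<close>
  define w2 :: "real^'n" where "w2 = (1/2) *\<^sub>R axis p 1"
  define N2 where "N2 = (\<chi> j. w2 + 1 *\<^sub>R N3 $ j)"
  have pos2: "0 < w2 \<bullet> vertex N3 S + 1" for S
    using vertexD[OF N3, of p S] by (cases "p \<in> S") (simp_all add: w2_def inner_axis')
  note step3 = cube_matrix_perspective[OF N3 zero_less_one pos2, folded N2_def]
  have "N2 $ j = (if j = p then 1 else 1 / (2 * b \<delta> j)) *\<^sub>R N1 $ j" for j
  proof (rule vec_eq_iff[THEN iffD2], rule allI)
    fix k
    have N1: "N1 $ j $ k = (if k = p then b \<delta> j else \<delta> * (N $ j $ k - N $ p $ k))"
      by (simp add: N1_def w1_def axis_def b_def algebra_simps)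
    have N2: "N2 $ j $ k = (if k = p then 1/2 else 0) + N3 $ j $ k"
      by (simp add: N2_def w2_def axis_def)
    show "N2 $ j $ k = ((if j = p then 1 else 1 / (2 * b \<delta> j)) *\<^sub>R N1 $ j) $ k"
      using \<delta>(2)[of j] by (simp add: N1 N2 N3_nth bp)
  qed
  then have "normally_equivalent (cube_of N1) (cube_of N2)"
    using \<delta>(2)
    by (intro normally_equivalent_row_scaling[where d = "\<lambda>j. if j = p then 1 else 1 / (2 * b \<delta> j)"]
        step1 step3) auto
  then have "cube_step (cube_of N) (cube_of N1)" "cube_step (cube_of N1) (cube_of N2)"
    "cube_step (cube_of N2) (cube_of N3)"
    using step1 step3 N N3 projectively_equivalent_sym
    by (auto simp: cube_step_def combinatorial_cube_cube_of)
  then have "(cube_step ^^ 3) (cube_of N) (cube_of N3)"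
    by (auto simp: numeral_3_eq_3)
  \<comment> \<open>Away from row and column \<open>p\<close>, the new entry is a multiple of a
    difference of two entries in column \<open>k\<close> of \<open>N\<close>; both are off the
    diagonal and vanish if that column was cleared.\<close>
  moreover have "N3 $ j $ k = 0" if "k = p \<or> (\<forall>i. i \<noteq> k \<longrightarrow> N $ i $ k = 0)" "j \<noteq> k" for k j
    using that by (auto simp: N3_nth)
  ultimately show thesis using that N3 by blast
qed

lemma eliminate_columns:
  fixes N :: "real^'n^'n"
  assumes "finite A" "cube_matrix N"
  shows "\<exists>N'. cube_matrix N' \<and> (cube_step ^^ (3 * card A)) (cube_of N) (cube_of N') \<and>
    (\<forall>k\<in>A. \<forall>j. j \<noteq> k \<longrightarrow> N' $ j $ k = 0)"
  using assms(1)
proof (induction A rule: finite_induct)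
  case empty
  show ?case using assms(2) by auto
next
  case (insert p A)
  then obtain M where M: "cube_matrix M" "(cube_step ^^ (3 * card A)) (cube_of N) (cube_of M)"
    "\<And>k j. k \<in> A \<Longrightarrow> j \<noteq> k \<Longrightarrow> M $ j $ k = 0" by blast
  obtain N' where N': "cube_matrix N'" "(cube_step ^^ 3) (cube_of M) (cube_of N')"
    "\<And>k j. k = p \<or> (\<forall>i. i \<noteq> k \<longrightarrow> M $ i $ k = 0) \<Longrightarrow> j \<noteq> k \<Longrightarrow> N' $ j $ k = 0"
    using eliminate_column[OF M(1)] by blast
  have "(cube_step ^^ (3 * card (insert p A))) (cube_of N) (cube_of N')"
    using relpowp_trans[OF M(2) N'(2)] insert.hyps by (simp add: add.commute)
  moreover have "N' $ j $ k = 0" if "k \<in> insert p A" "j \<noteq> k" for j k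
    using that M(3) by (intro N'(3)) auto
  ultimately show ?case using N'(1) by blast
qed

text \<open>At the vertex \<open>{i}\<close> the equation reads
  \<open>N\<^sub>i\<^sub>i x\<^sub>i = 1\<close> with \<open>x\<^sub>i > 0\<close>. So the diagonal
  entries are positive and corresponding rows are positive multiples of each other.\<close>

lemma diagonal_cubes_normally_equivalent:
  fixes N N' :: "real^'n^'n"
  assumes N: "cube_matrix N" "\<And>j k. j \<noteq> k \<Longrightarrow> N $ j $ k = 0"
    and N': "cube_matrix N'" "\<And>j k. j \<noteq> k \<Longrightarrow> N' $ j $ k = 0"
  shows "normally_equivalent (cube_of N) (cube_of N')"
proof -
  have pos: "0 < M $ i $ i" if M: "cube_matrix M" "\<And>j k. j \<noteq> k \<Longrightarrow> M $ j $ k = 0" for M :: "real^'n^'n" and i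
  proof -
    have "(M *v vertex M {i}) $ i = M $ i $ i * vertex M {i} $ i"
      using sum_UNIV_single[of i "\<lambda>k. M $ i $ k * vertex M {i} $ k"] M(2)[of i]
      by (simp add: matrix_vector_mult_def)
    then have "M $ i $ i * vertex M {i} $ i = 1"
      using vertexD(2)[OF M(1), of i "{i}"] by simp
    then show ?thesis
      using vertexD(1)[OF M(1), of i "{i}"] by (metis insertI1 zero_less_mult_pos2 zero_less_one)
  qed
  show ?thesis
  proof (rule normally_equivalent_row_scaling[OF N(1) N'(1), of "\<lambda>i. N' $ i $ i / N $ i $ i"])
    show "0 < N' $ i $ i / N $ i $ i" for i
      using pos[OF N] pos[OF N'] by simp
    show "N' $ i = (N' $ i $ i / N $ i $ i) *\<^sub>R N $ i" for i
    proof (rule vec_eq_iff[THEN iffD2], rule allI)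
      fix k
      show "N' $ i $ k = ((N' $ i $ i / N $ i $ i) *\<^sub>R N $ i) $ k"
        using pos[OF N, of i] N(2)[of i k] N'(2)[of i k] by (cases "i = k") auto
    qed
  qed
qed

section \<open>The realization space\<close>

text \<open>In the shifted coordinates \<open>x = v + 1/2\<close>, the vertex \<open>{i, j}\<close>
  satisfies \<open>x\<^sub>i + N\<^sub>i\<^sub>j x\<^sub>j = 1\<close>, solved here for
  \<open>N\<^sub>i\<^sub>j\<close>.\<close>

definition slope_matrix :: "(real^'n)^('n set) \<Rightarrow> real^'n^'n" where
  "slope_matrix v = (\<chi> i j. if i = j then 1
     else (1/2 - v $ {i, j} $ i) / (v $ {i, j} $ j + 1/2))"

text \<open>The shift moves the vertices \<open>{}\<close> and \<open>{i}\<close> to the origin and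
  the unit vectors. This makes one family of facets the coordinate hyperplanes and lets the other be
  scaled to right-hand side one with unit diagonal; the vertices \<open>{i, j}\<close> then identify
  the matrix.\<close>

lemma realization_space_vertex:
  fixes v :: "(real^'n)^('n set)"
  assumes "v \<in> cube_realization_space"
  shows "is_cube_vertex (slope_matrix v) S (v $ S + (\<chi> i. 1/2))"
proof -
  have vR: "v \<in> cube_realizations" and v0: "v $ {} = standard_cube $ {}"
    and v1: "\<And>i. v $ {i} = standard_cube $ {i}"
    using assms by (auto simp: cube_realization_space_def)
  obtain a \<beta> where sup: "cube_supports (($) v) a \<beta>"
    using vR cube_realizations_iff_supports by blast
  define h :: "real^'n" where "h = (\<chi> i. 1/2)"
  define x where "x S = v $ S + h" for S
  define g where "g i e = \<beta> i e + a i e \<bullet> h" for i e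
  have x: "cube_supports x a g"
    using sup by (simp add: cube_supports_def x_def g_def inner_add_right)
  note xD = cube_supportsD[OF x]
  have x0: "x {} = 0" by (simp add: x_def v0 h_def standard_cube_def vec_eq_iff)
  have x1: "x {i} = axis i 1" for i
    by (simp add: x_def v1 h_def standard_cube_def vec_eq_iff axis_def)
  have g0: "g i False = 0" for i using xD(1)[of i "{}" False] by (simp add: x0)
  have g1: "0 < g i True" for i using xD(2)[of i "{}" True] by (simp add: x0)
  \<comment> \<open>The facet contains the origin and every \<open>axis j 1\<close> with
    \<open>j \<noteq> i\<close>, so its normal is a multiple of \<open>axis i 1\<close>.\<close>
  have aF: "a i False $ j = 0" if "j \<noteq> i" for i j
    using xD(1)[of i "{j}" False] that by (simp add: x1 g0 inner_axis)
  have aF': "a i False $ i < 0" for i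
    using xD(2)[of i "{i}" False] by (simp add: x1 g0 inner_axis)
  have aFx: "a i False \<bullet> y = a i False $ i * y $ i" for i y
    using sum_UNIV_single[of i "\<lambda>k. a i False $ k * y $ k"] aF by (simp add: inner_vec_def)
  have xpos: "0 < x S $ i" if "i \<in> S" for i S
    using xD(2)[of i S False] that aF'[of i] by (simp add: aFx g0 mult_less_0_iff)
  have xzero: "x S $ i = 0" if "i \<notin> S" for i S
    using xD(1)[of i S False] that aF'[of i] by (simp add: aFx g0)
  define N where "N = (\<chi> i. a i True /\<^sub>R g i True)"
  have Nx: "(N *v y) $ i = (a i True \<bullet> y) / g i True" for i y
    by (simp add: N_def matrix_vector_mul_component divide_inverse mult.commute)
  have vert: "is_cube_vertex N S (x S)" for S
    unfolding is_cube_vertex_def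
  proof (intro conjI ballI)
    fix i assume "i \<in> S"
    then show "0 < x S $ i" "(N *v x S) $ i = 1"
      using xpos xD(1)[of i S True] g1[of i] by (simp_all add: Nx)
  next
    fix i assume "i \<in> - S"
    then show "x S $ i = 0" "(N *v x S) $ i < 1"
      using xzero xD(2)[of i S True] g1[of i] by (simp_all add: Nx)
  qed
  have diag: "N $ i $ i = 1" for i
    using vert[of "{i}"] by (simp add: is_cube_vertex_def x1 matrix_vector_mul_component inner_axis)
  have "N $ i $ j = slope_matrix v $ i $ j" for i j
  proof (cases "i = j")
    case False
    have "(N *v x {i, j}) $ i = (\<Sum>k\<in>{i, j}. N $ i $ k * x {i, j} $ k)"
      unfolding matrix_vector_mult_def
      by (simp, intro sum.mono_neutral_right) (auto simp: xzero)
    also have "\<dots> = x {i, j} $ i + N $ i $ j * x {i, j} $ j"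
      using False by (simp add: diag)
    finally have "x {i, j} $ i + N $ i $ j * x {i, j} $ j = 1"
      using vert[of "{i, j}"] by (simp add: is_cube_vertex_def)
    moreover have "0 < x {i, j} $ j" by (simp add: xpos)
    ultimately have "N $ i $ j = (1 - x {i, j} $ i) / x {i, j} $ j"
      by (simp add: field_simps)
    then show ?thesis
      using False by (simp add: slope_matrix_def x_def h_def)
  qed (simp add: diag slope_matrix_def)
  then have "N = slope_matrix v" by (simp add: vec_eq_iff)
  with vert show ?thesis by (simp add: x_def h_def)
qed

lemma realization_space_cube_matrix:
  "v \<in> cube_realization_space \<Longrightarrow> cube_matrix (slope_matrix v)"
  using realization_space_vertex unfolding cube_matrix_def by blast

lemma vertex_slope_matrix:
  assumes "v \<in> cube_realization_space"
  shows "vertex (slope_matrix v) S = v $ S + (\<chi> i. 1/2)"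
  using realization_space_vertex[OF assms] is_cube_vertex_iff[OF realization_space_cube_matrix[OF assms]]
  by simp

definition matrix_realization :: "real^'n^'n \<Rightarrow> (real^'n)^('n set)" where
  "matrix_realization N = (\<chi> S. vertex N S - (\<chi> i. 1/2))"

lemma matrix_realization_slope_matrix:
  "v \<in> cube_realization_space \<Longrightarrow> matrix_realization (slope_matrix v) = v"
  by (simp add: matrix_realization_def vertex_slope_matrix vec_eq_iff)

text \<open>The unit diagonal puts \<open>vertex N {i}\<close> at \<open>axis i 1\<close>, as the
  affine normal form demands after the shift.\<close>

lemma matrix_realization_in_space:
  fixes N :: "real^'n^'n"
  assumes N: "cube_matrix N" and diag: "\<And>i. N $ i $ i = 1"
  shows "matrix_realization N \<in> cube_realization_space"
proof -
  have "matrix_realization N = (\<chi> S. mat 1 *v ((\<chi> S. vertex N S) $ S) + - (\<chi> i. 1/2))"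
    by (simp add: matrix_realization_def)
  also have "\<dots> \<in> cube_realizations"
    by (intro cube_realization_affine_image cube_matrix_realization N) (auto simp: invertible_def)
  finally have "matrix_realization N \<in> cube_realizations" .
  moreover have "vertex N {} = 0"
    using vertexD(3)[OF N, of _ "{}"] by (simp add: vec_eq_iff)
  moreover have "vertex N {i} = axis i 1" for i
  proof -
    have off: "vertex N {i} $ j = 0" if "j \<noteq> i" for j
      using vertexD(3)[OF N, of j "{i}"] that by simp
    have "(N *v vertex N {i}) $ i = vertex N {i} $ i"
      using sum_UNIV_single[of i "\<lambda>k. N $ i $ k * vertex N {i} $ k"] off
      by (simp add: matrix_vector_mult_def diag)
    then have "vertex N {i} $ i = 1"
      using vertexD(2)[OF N, of i "{i}"] by simp
    with off show ?thesis by (auto simp: vec_eq_iff axis_def)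
  qed
  ultimately show ?thesis
    by (simp add: cube_realization_space_def matrix_realization_def standard_cube_def
        vec_eq_iff axis_def)
qed

section \<open>Starlikeness about the identity matrix\<close>

lemma cube_matrix_mat_1: "cube_matrix (mat 1)"
proof -
  have "is_cube_vertex (mat 1) S (cube_vertex S)" for S :: "'a set"
    by (simp add: is_cube_vertex_def cube_vertex_def)
  then show ?thesis by (auto simp: cube_matrix_def)
qed

lemma matrix_realization_mat_1: "matrix_realization (mat 1) = standard_cube"
proof -
  have "vertex (mat 1) S = cube_vertex S" for S :: "'a set"
    using is_cube_vertex_iff[OF cube_matrix_mat_1, of S "cube_vertex S"]
    by (simp add: is_cube_vertex_def cube_vertex_def)
  then show ?thesis
    by (simp add: matrix_realization_def standard_cube_def cube_vertex_def vec_eq_iff)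
qed

lemma slope_matrix_standard_cube: "slope_matrix standard_cube = mat 1"
  by (simp add: slope_matrix_def standard_cube_def mat_def vec_eq_iff)

text \<open>Increasing \<open>N\<^sub>i\<^sub>i\<close> rotates the facet \<open>(N x)\<^sub>i = 1\<close> around its intersection with
  the facet \<open>x\<^sub>i = 0\<close>; the vertices on it slide along the edges towards that facet.\<close>

lemma cube_matrix_increase_diagonal_entry:
  fixes N :: "real^'n^'n"
  assumes N: "cube_matrix N" and \<mu>: "0 \<le> \<mu>"
  shows "cube_matrix (\<chi> j k. N $ j $ k + (if j = i \<and> k = i then \<mu> else 0))" (is "cube_matrix ?N")
  unfolding cube_matrix_def
proof
  fix S
  have mult: "(?N *v z) $ j = (N *v z) $ j + (if j = i then \<mu> * z $ i else 0)" for z j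
  proof -
    have "(\<Sum>k\<in>UNIV. (N $ j $ k + (if j = i \<and> k = i then \<mu> else 0)) * z $ k)
        = (\<Sum>k\<in>UNIV. N $ j $ k * z $ k + (if k = i then (if j = i then \<mu> * z $ i else 0) else 0))"
      by (rule sum.cong) (auto simp: algebra_simps)
    then show ?thesis by (simp add: matrix_vector_mult_def sum.distrib)
  qed
  show "\<exists>z. is_cube_vertex ?N S z"
  proof (cases "i \<in> S")
    case False
    \<comment> \<open>Here the vertex has \<open>x\<^sub>i = 0\<close>, so the changed diagonal
      entry does not affect it.\<close>
    then have "is_cube_vertex ?N S (vertex N S)"
      using is_cube_vertex_vertex[OF N, of S] vertexD(3)[OF N False]
      by (auto simp: is_cube_vertex_def mult)
    then show ?thesis by blast
  next
    case True
    define x y where "x = vertex N S" and "y = vertex N (S - {i})"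
    note x = vertexD[OF N, of _ S, folded x_def] and y = vertexD[OF N, of _ "S - {i}", folded y_def]
    \<comment> \<open>\<open>q\<close> is the slack of \<open>y\<close> at facet \<open>i\<close>.
      On the edge from \<open>y\<close> to \<open>x\<close> the slack is \<open>(1 - t) q\<close>
      and the added term is \<open>t \<mu> x\<^sub>i\<close>; this \<open>t\<close> balances
      them.\<close>
    define q t where "q = 1 - (N *v y) $ i" and "t = q / (q + \<mu> * x $ i)"
    have q: "0 < q" using y(4)[of i] by (simp add: q_def)
    have den: "0 < q + \<mu> * x $ i" using q \<mu> x(1)[OF True] by (simp add: add_pos_nonneg)
    have t: "0 < t" "t \<le> 1" using q den \<mu> x(1)[OF True] by (auto simp: t_def)
    have tq: "(1 - t) * q = t * (\<mu> * x $ i)" using den by (simp add: t_def field_simps)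
    define z where "z = (1 - t) *\<^sub>R y + t *\<^sub>R x"
    have Nz: "(N *v z) $ j = (1 - t) * (N *v y) $ j + t * (N *v x) $ j" for j
      by (simp add: z_def matrix_vector_mul_component inner_add_right)
    have zj: "z $ j = (1 - t) * y $ j + t * x $ j" for j by (simp add: z_def)
    have "is_cube_vertex ?N S z"
      unfolding is_cube_vertex_def
    proof (intro conjI ballI)
      fix j assume j: "j \<in> S"
      have "0 \<le> y $ j" using y(1,3)[of j] by (cases "j = i") (auto simp: j less_imp_le)
      then show "0 < z $ j"
        unfolding zj using x(1)[OF j] t by (intro add_nonneg_pos) auto
      show "(?N *v z) $ j = 1"
      proof (cases "j = i")
        case True
        have "(?N *v z) $ i = (1 - t) * (1 - q) + t + \<mu> * (t * x $ i)"
          using x(2)[OF \<open>i \<in> S\<close>] y(3)[of i] by (simp add: mult Nz zj q_def)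
        also have "\<dots> = 1 - (1 - t) * q + t * (\<mu> * x $ i)" by (simp add: algebra_simps)
        finally show ?thesis using tq True by simp
      next
        case False
        then show ?thesis using x(2)[OF j] y(2)[of j] j by (simp add: mult Nz)
      qed
    next
      fix j assume "j \<in> - S"
      then have j: "j \<notin> S" "j \<noteq> i" using True by auto
      show "z $ j = 0" using x(3)[of j] y(3)[of j] j by (simp add: zj)
      have "(1 - t) * (N *v y) $ j \<le> (1 - t) * 1"
        using y(4)[of j] j t by (intro mult_left_mono) auto
      moreover have "t * (N *v x) $ j < t * 1"
        using x(4)[of j] j t by (intro mult_strict_left_mono) auto
      ultimately show "(?N *v z) $ j < 1" using j by (simp add: mult Nz)
    qed
    then show ?thesis by blast
  qed
qed

text \<open>The diagonal entries are raised one after another.\<close>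

lemma cube_matrix_add_scalar:
  fixes N :: "real^'n^'n"
  assumes N: "cube_matrix N" and \<mu>: "0 \<le> \<mu>"
  shows "cube_matrix (N + mat \<mu>)"
proof -
  have "cube_matrix (\<chi> j k. N $ j $ k + (if j = k \<and> j \<in> A then \<mu> else 0))" if "finite A" for A
    using that
  proof (induction A rule: finite_induct)
    case empty
    then show ?case using N by simp
  next
    case (insert i A)
    have "(\<chi> j k. N $ j $ k + (if j = k \<and> j \<in> insert i A then \<mu> else 0))
      = (\<chi> j k. (\<chi> j k. N $ j $ k + (if j = k \<and> j \<in> A then \<mu> else 0)) $ j $ k
          + (if j = i \<and> k = i then \<mu> else 0))"
      using insert.hyps by (auto simp: vec_eq_iff)
    then show ?case
      using cube_matrix_increase_diagonal_entry[OF insert.IH \<mu>] by simp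
  qed
  from this[of UNIV] have "cube_matrix (\<chi> j k. N $ j $ k + (if j = k then \<mu> else 0))" by simp
  moreover have "(\<chi> j k. N $ j $ k + (if j = k then \<mu> else 0)) = N + mat \<mu>"
    by (simp add: vec_eq_iff mat_def)
  ultimately show ?thesis by simp
qed

text \<open>For \<open>t > 0\<close> the point on the segment is \<open>t\<close> times
  \<open>N + mat ((1 - t) / t)\<close>: a diagonal increase followed by a dilation.\<close>

lemma cube_matrix_starlike:
  fixes N :: "real^'n^'n"
  assumes N: "cube_matrix N" and t: "0 \<le> t" "t \<le> 1"
  shows "cube_matrix (mat 1 + t *\<^sub>R (N - mat 1))"
proof (cases "t = 0")
  case True
  then show ?thesis by (simp add: cube_matrix_mat_1)
next
  case False
  with t have t0: "0 < t" by simp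
  have "cube_matrix (\<chi> i k. (N + mat ((1 - t) / t)) $ i $ k * t)"
    using t t0 by (intro cube_matrix_column_scaling cube_matrix_add_scalar N) auto
  moreover have "(\<chi> i k. (N + mat ((1 - t) / t)) $ i $ k * t) = mat 1 + t *\<^sub>R (N - mat 1)"
    using t0 by (auto simp: vec_eq_iff mat_def field_simps)
  ultimately show ?thesis by simp
qed

section \<open>Continuity and the deformation\<close>

text \<open>By Cramer's rule the coordinates are quotients of polynomials in the entries of
  \<open>N\<close>, with nonzero denominators for cube matrices.\<close>

lemma continuous_on_matrix_realization:
  "continuous_on {N. cube_matrix N} (matrix_realization :: real^'n^'n \<Rightarrow> _)"
proof -
  have entry: "continuous_on {N. cube_matrix N} (\<lambda>N :: real^'n^'n. vertex_system N S $ i $ j)" for S i j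
    by (cases "i \<in> S") (simp_all add: vertex_system_def continuous_intros)
  have "continuous_on {N. cube_matrix N} (\<lambda>N :: real^'n^'n. det (vertex_system N S))" for S
    unfolding det_def by (intro continuous_intros entry)
  moreover have "continuous_on {N. cube_matrix N} (\<lambda>N :: real^'n^'n.
      det (\<chi> i j. if j = k then cube_vertex S $ i else vertex_system N S $ i $ j))" for S k
  proof -
    have "continuous_on {N. cube_matrix N} (\<lambda>N :: real^'n^'n.
        if j = k then cube_vertex S $ i else vertex_system N S $ i $ j)" for i j
      using entry by (cases "j = k") simp_all
    then show ?thesis
      unfolding det_def by (simp only: vec_lambda_beta) (intro continuous_intros)
  qed
  ultimately show ?thesis
    unfolding matrix_realization_def vertex_def
    by (intro continuous_intros) (auto simp: cube_matrix_det_vertex_system)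
qed

text \<open>The denominators are coordinates of shifted vertices \<open>{i, j}\<close> in direction
  \<open>j\<close>, which are positive.\<close>

lemma continuous_on_slope_matrix:
  "continuous_on cube_realization_space (slope_matrix :: (real^'n)^('n set) \<Rightarrow> _)"
proof -
  have "v $ {i, j} $ j + 1/2 \<noteq> 0" if "v \<in> cube_realization_space" for v :: "(real^'n)^('n set)" and i j
    using realization_space_vertex[OF that, of "{i, j}"] by (auto simp: is_cube_vertex_def)
  then have "continuous_on cube_realization_space (\<lambda>v :: (real^'n)^('n set). slope_matrix v $ i $ j)" for i j
    by (cases "i = j") (auto simp: slope_matrix_def intro!: continuous_intros)
  then have "continuous_on cube_realization_space (\<lambda>v :: (real^'n)^('n set). \<chi> i j. slope_matrix v $ i $ j)"
    by (intro continuous_on_vec_lambda)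
  then show ?thesis by simp
qed

text \<open>The segment from the slope matrix to the identity is read back as a path of
  realizations. It keeps the diagonal equal to one, hence stays in the normal form, and it is
  constant at the standard cube.\<close>

lemma cube_realization_space_homotopy:
  "homotopic_with_canon (\<lambda>h. \<forall>a\<in>{standard_cube}. h a = a)
     (cube_realization_space :: ((real^'n)^('n set)) set) cube_realization_space id (\<lambda>_. standard_cube)"
proof -
  let ?X = "cube_realization_space :: ((real^'n)^('n set)) set"
  define L :: "real \<times> ((real^'n)^('n set)) \<Rightarrow> real^'n^'n" where
    "L = (\<lambda>(t, v). mat 1 + (1 - t) *\<^sub>R (slope_matrix v - mat 1))"
  define H where "H = matrix_realization \<circ> L"
  have L: "cube_matrix (L (t, v))" "\<And>i. L (t, v) $ i $ i = 1" if "t \<in> {0..1}" "v \<in> ?X" for t v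
    using that cube_matrix_starlike[OF realization_space_cube_matrix[OF that(2)], of "1 - t"]
    by (simp_all add: L_def slope_matrix_def mat_def)
  have "continuous_on ({0..1} \<times> ?X) (\<lambda>z. slope_matrix (snd z))"
    by (rule continuous_on_compose2[OF continuous_on_slope_matrix]) (auto intro: continuous_intros)
  then have "continuous_on ({0..1} \<times> ?X) L"
    unfolding L_def case_prod_beta by (intro continuous_intros)
  then have "continuous_on ({0..1} \<times> ?X) H"
    unfolding H_def
    by (intro continuous_on_compose continuous_on_subset[OF continuous_on_matrix_realization])
      (auto simp: L)
  moreover have "H ` ({0..1} \<times> ?X) \<subseteq> ?X"
    using L by (auto simp: H_def intro!: matrix_realization_in_space)
  moreover have "H (0, v) = v" if "v \<in> ?X" for v
    using that by (simp add: H_def L_def matrix_realization_slope_matrix)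
  moreover have "H (1, v) = standard_cube" for v
    by (simp add: H_def L_def matrix_realization_mat_1)
  moreover have "H (t, standard_cube) = standard_cube" for t
    by (simp add: H_def L_def slope_matrix_standard_cube matrix_realization_mat_1)
  ultimately show ?thesis
    by (subst homotopic_with)
      (auto intro!: exI[of _ H] simp: standard_cube_realization)
qed

section \<open>Chains between arbitrary combinatorial cubes\<close>

text \<open>The affine normalisation is itself a projective transformation, so it costs one
  step.\<close>

lemma combinatorial_cube_step_cube_of:
  fixes Q :: "(real^'n) set"
  assumes Q: "combinatorial_cube Q"
  obtains N where "cube_matrix N" "cube_step Q (cube_of N)"
proof -
  obtain v where v: "v \<in> cube_realizations" "Q = convex hull (range (($) v))"
    using combinatorial_cube_obtain_realization[OF Q] .
  obtain A b where A: "invertible A" and w: "(\<chi> S. A *v (v $ S) + b) \<in> cube_realization_space"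
    using cube_realization_affine_normal_form[OF v(1)] by auto
  define N where "N = slope_matrix (\<chi> S. A *v (v $ S) + b)"
  have N: "cube_matrix N" unfolding N_def by (rule realization_space_cube_matrix[OF w])
  define c where "c = b + (\<chi> i. 1/2)"
  have vert: "vertex N S = A *v (v $ S) + c" for S
    using vertex_slope_matrix[OF w] by (simp add: N_def c_def add.assoc)
  have "cube_of N = convex hull ((+) c ` ((*v) A ` range (($) v)))"
    unfolding cube_of_def by (rule arg_cong[of _ _ "\<lambda>V. convex hull V"])
      (auto simp: vert image_image add.commute)
  also have "\<dots> = (+) c ` ((*v) A ` Q)"
    unfolding v(2) convex_hull_translation by (simp add: convex_hull_linear_image)
  also have "\<dots> = (\<lambda>x. A *v x + c) ` Q"
    by (simp add: image_image add.commute)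
  finally have "projectively_equivalent Q (cube_of N)"
    using affine_image_projectively_equivalent[OF A] by metis
  with N Q have "cube_step Q (cube_of N)"
    by (simp add: cube_step_def combinatorial_cube_cube_of)
  with N show thesis by (rule that)
qed

text \<open>Each side needs one step to normalise and three per column, and one normal step joins
  the diagonal forms. The total \<open>6 d + 3\<close> is at most \<open>8 d\<close> once
  \<open>d \<ge> 2\<close>.\<close>

lemma combinatorial_cubes_steps:
  fixes Q Q' :: "(real^'n) set"
  assumes "combinatorial_cube Q" "combinatorial_cube Q'"
  shows "\<exists>s. 0 < s \<and> s \<le> 8 * CARD('n) \<and> (cube_step ^^ s) Q Q'"
proof -
  \<comment> \<open>In dimension one every matrix is diagonal; omitting the elimination gives three
    steps, whereas nine would exceed the bound.\<close>
  define A where "A = (if CARD('n) = 1 then {} else UNIV :: 'n set)"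
  have diag: "\<exists>M. cube_matrix M \<and> (\<forall>j k. j \<noteq> k \<longrightarrow> M $ j $ k = 0) \<and>
      (cube_step ^^ Suc (3 * card A)) R (cube_of M)" if R: "combinatorial_cube R" for R :: "(real^'n) set"
  proof -
    obtain N where N: "cube_matrix N" "cube_step R (cube_of N)"
      using combinatorial_cube_step_cube_of[OF R] .
    obtain M where M: "cube_matrix M" "(cube_step ^^ (3 * card A)) (cube_of N) (cube_of M)"
      "\<And>k j. k \<in> A \<Longrightarrow> j \<noteq> k \<Longrightarrow> M $ j $ k = 0"
      using eliminate_columns[of A, OF _ N(1)] by auto
    have "M $ j $ k = 0" if "j \<noteq> k" for j k
    proof (rule M(3)[OF _ that])
      have "CARD('n) \<noteq> 1" using that by (metis UNIV_I card_1_singletonE singletonD)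
      then show "k \<in> A" by (simp add: A_def)
    qed
    with M(1,2) N(2) show ?thesis by (meson relpowp_Suc_I2)
  qed
  obtain M where M: "cube_matrix M" "\<And>j k. j \<noteq> k \<Longrightarrow> M $ j $ k = 0"
    "(cube_step ^^ Suc (3 * card A)) Q (cube_of M)" using diag[OF assms(1)] by blast
  obtain M' where M': "cube_matrix M'" "\<And>j k. j \<noteq> k \<Longrightarrow> M' $ j $ k = 0"
    "(cube_step ^^ Suc (3 * card A)) Q' (cube_of M')" using diag[OF assms(2)] by blast
  have "cube_step (cube_of M) (cube_of M')"
    using diagonal_cubes_normally_equivalent[OF M(1,2) M'(1,2)] M(1) M'(1)
    by (simp add: cube_step_def combinatorial_cube_cube_of)
  then have "(cube_step ^^ Suc (Suc (3 * card A))) Q (cube_of M')"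
    using M(3) by (rule relpowp_Suc_I[rotated])
  then have "(cube_step ^^ (Suc (Suc (3 * card A)) + Suc (3 * card A))) Q Q'"
    using cube_steps_sym[OF M'(3)] by (rule relpowp_trans)
  moreover have "Suc (Suc (3 * card A)) + Suc (3 * card A) \<le> 8 * CARD('n)"
  proof (cases "CARD('n) = 1")
    case False
    moreover have "0 < CARD('n)" by simp
    ultimately have "2 \<le> CARD('n)" by linarith
    then show ?thesis by (simp add: A_def)
  qed (simp add: A_def)
  ultimately show ?thesis by (intro exI[of _ "Suc (Suc (3 * card A)) + Suc (3 * card A)"]) simp
qed

theorem theorem1p1:
  shows "(\<forall>Q Q' :: (real^'n) set.
            combinatorial_cube Q \<and> combinatorial_cube Q' \<longrightarrow>
            (\<exists>(s::nat) (P :: nat \<Rightarrow> (real^'n) set).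
               0 < s \<and> s \<le> 8 * CARD('n) \<and> P 0 = Q \<and> P s = Q' \<and>
               (\<forall>j\<le>s. combinatorial_cube (P j)) \<and>
               (\<forall>j\<in>{1..s}. projectively_equivalent (P (j - 1)) (P j) \<or>
                            normally_equivalent (P (j - 1)) (P j))))
         \<and> contractible (cube_realization_space :: ((real^'n)^('n set)) set)
         \<and> deformation_retracts_onto (cube_realization_space :: ((real^'n)^('n set)) set) {standard_cube}"
proof (intro conjI allI impI)
  fix Q Q' :: "(real^'n) set"
  assume "combinatorial_cube Q \<and> combinatorial_cube Q'"
  then have Q: "combinatorial_cube Q" "combinatorial_cube Q'" by auto
  then obtain s where s: "0 < s" "s \<le> 8 * CARD('n)" "(cube_step ^^ s) Q Q'"
    using combinatorial_cubes_steps by blast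
  from s(3) obtain P where P: "P 0 = Q" "P s = Q'" "\<And>j. j < s \<Longrightarrow> cube_step (P j) (P (Suc j))"
    by (auto simp: relpowp_fun_conv)
  \<comment> \<open>The last polytope has no outgoing step; there the assumption on
    \<open>Q'\<close> applies.\<close>
  have "combinatorial_cube (P j)" if "j \<le> s" for j
    using P(2) P(3)[of j] Q(2) that by (cases "j = s") (auto simp: cube_step_def)
  moreover have "projectively_equivalent (P (j - 1)) (P j) \<or> normally_equivalent (P (j - 1)) (P j)"
    if "j \<in> {1..s}" for j
    using P(3)[of "j - 1"] that by (auto simp: cube_step_def)
  ultimately show "\<exists>(s::nat) (P :: nat \<Rightarrow> (real^'n) set).
      0 < s \<and> s \<le> 8 * CARD('n) \<and> P 0 = Q \<and> P s = Q' \<and>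
      (\<forall>j\<le>s. combinatorial_cube (P j)) \<and>
      (\<forall>j\<in>{1..s}. projectively_equivalent (P (j - 1)) (P j) \<or>
                   normally_equivalent (P (j - 1)) (P j))"
    using s(1,2) P(1,2) by blast
next
  have "homotopic_with_canon (\<lambda>x. True) (cube_realization_space :: ((real^'n)^('n set)) set)
      cube_realization_space id (\<lambda>_. standard_cube)"
    using cube_realization_space_homotopy by (rule homotopic_with_mono) simp
  then show "contractible (cube_realization_space :: ((real^'n)^('n set)) set)"
    unfolding contractible_def by blast
  have "retraction (cube_realization_space :: ((real^'n)^('n set)) set) {standard_cube} (\<lambda>_. standard_cube)"
    by (auto simp: retraction_def standard_cube_realization)
  then show "deformation_retracts_onto (cube_realization_space :: ((real^'n)^('n set)) set) {standard_cube}"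
    unfolding deformation_retracts_onto_def using cube_realization_space_homotopy by blast
qed

end
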